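(* In the setting of the context, assume that, with $\Gamma:=\int_0^1|\gamma(s)|\,ds$, for some constant $M$ and some nondecreasing continuous $g:[0,\infty)\to[0,\infty)$ with $g(r)>0$ for $r>0$: (i) $|F(\psi)|\le M$ for any $\psi\in\mathbb R$; (ii) $|H(z)|\le g(|z|)$ for any $z\in\mathbb R$; (iv) $\displaystyle \Gamma<\int_{N+\Gamma\sqrt{2(M+|d|)}}^\infty\frac{du}{\sqrt{2g(u)}}$; $(A_1)$ $f$ is odd and continuous; $(A_2)$ $\gamma$ is odd and continuous; $(A_3)$ $\left[-d-M,\,-d+M+\frac{M_1^2}{2}\right]\subset J$, where $N$ and $M_1$ are the constants defined in the context. Then the equation $$\ddot\psi=f(\psi)+\gamma(t)\,h\Big(H^{-1}\Big(\tfrac{\dot\psi^2}{2}-F(\psi)-d\Big)\Big)$$ has a $1$-periodic odd solution.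
   Context: Setting: $h:\mathbb R\to\mathbb R$ is continuous, $f:\mathbb R\to\mathbb R$, $\gamma:\mathbb R\to\mathbb R$ is $1$-periodic, $d\in\mathbb R$ is a fixed constant, $F(\psi)=\int_0^\psi f(u)\,du$, $H(z)=\int_0^z h(u)\,du$. It is assumed that $I,J\subseteq\mathbb R$ are open intervals and $H:I\to J$ is a diffeomorphism of $I$ onto $J$ (so $h\neq0$ on $I$), with inverse $H^{-1}:J\to I$. Constants: $N:=\sup\{|H^{-1}(-\lambda F(\psi)-d)| : \psi\in\mathbb R,\ \lambda\in[0,1]\}$ (well defined and finite since $(A_3)$ contains $[-d-M,-d+M]\subset J$), and $$M_1:=\sqrt{2\Big(|d|+M+g\big(G^{-1}\big(G(N+\Gamma\sqrt{2(|d|+M)})+\Gamma\big)\big)\Big)},\qquad G(x):=\int_1^x\frac{du}{\sqrt{2g(u)}},$$ with $G^{-1}$ the inverse of $G$ (condition (iv) says exactly that the argument of $G^{-1}$ is less than $\int_1^\infty du/\sqrt{2g(u)}$; in the degenerate case $G(0)=-\infty$ one reads $G^{-1}(-\infty)=0$). A solution is a $C^2$ function $\psi:\mathbb R\to\mathbb R$ satisfying the equation with $\frac{\dot\psi(t)^2}{2}-F(\psi(t))-d\in J$ for all $t$. *)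

theory Defs
  imports "HOL-Analysis.Analysis"
begin

definition primitive :: "(real \<Rightarrow> real) \<Rightarrow> real \<Rightarrow> real" where
  "primitive f x = (LBINT u=0..x. f u)"

(* On open subsets of the real line; the derivatives are only required to be continuous,
   since the maps considered are primitives of functions that are merely continuous. *)
definition C1_diffeomorphism :: "(real \<Rightarrow> real) \<Rightarrow> real set \<Rightarrow> real set \<Rightarrow> bool" where
  "C1_diffeomorphism \<phi> A B \<longleftrightarrow>
     bij_betw \<phi> A B \<and> \<phi> C1_differentiable_on A \<and> inv_into A \<phi> C1_differentiable_on B"

definition odd_fun :: "(real \<Rightarrow> real) \<Rightarrow> bool" where
  "odd_fun f \<longleftrightarrow> (\<forall>x. f (- x) = - f x)"

definition one_periodic :: "(real \<Rightarrow> real) \<Rightarrow> bool" where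
  "one_periodic f \<longleftrightarrow> (\<forall>t. f (t + 1) = f t)"

definition Gam :: "(real \<Rightarrow> real) \<Rightarrow> real" where
  "Gam \<gamma> = (LBINT s=0..1. \<bar>\<gamma> s\<bar>)"

(* The inverse of H : I -> J, H being the primitive of h. *)
definition Hinv :: "(real \<Rightarrow> real) \<Rightarrow> real set \<Rightarrow> real \<Rightarrow> real" where
  "Hinv h I = inv_into I (primitive h)"

definition N_const :: "(real \<Rightarrow> real) \<Rightarrow> (real \<Rightarrow> real) \<Rightarrow> real set \<Rightarrow> real \<Rightarrow> real" where
  "N_const h f I d = Sup {\<bar>Hinv h I (- l * primitive f \<psi> - d)\<bar> | \<psi> l. 0 \<le> l \<and> l \<le> 1}"

(* The oriented integral of 1 / sqrt (2 g) from 1 to x, for x >= 0. It takes values in ereal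
   because the value at 0 is -\<infinity> when 1 / sqrt g is not integrable near 0. The value assigned
   to 1 / sqrt (2 g 0) when g 0 = 0 is irrelevant, as it concerns a null set only. *)
definition G_fun :: "(real \<Rightarrow> real) \<Rightarrow> real \<Rightarrow> ereal" where
  "G_fun g x =
     (if 1 \<le> x then enn2ereal (\<integral>\<^sup>+u\<in>{1..x}. ennreal (1 / sqrt (2 * g u)) \<partial>lborel)
      else - enn2ereal (\<integral>\<^sup>+u\<in>{x..1}. ennreal (1 / sqrt (2 * g u)) \<partial>lborel))"

(* If G_fun g 0 = -\<infinity>, then G_inv g (-\<infinity>) = 0. *)
definition G_inv :: "(real \<Rightarrow> real) \<Rightarrow> ereal \<Rightarrow> real" where
  "G_inv g = inv_into {0..} (G_fun g)"

definition M1_const ::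
  "(real \<Rightarrow> real) \<Rightarrow> (real \<Rightarrow> real) \<Rightarrow> (real \<Rightarrow> real) \<Rightarrow> (real \<Rightarrow> real) \<Rightarrow> real set \<Rightarrow> real \<Rightarrow> real \<Rightarrow> real"
  where
  "M1_const h f \<gamma> g I d M =
     sqrt (2 * (\<bar>d\<bar> + M +
       g (G_inv g (G_fun g (N_const h f I d + Gam \<gamma> * sqrt (2 * (\<bar>d\<bar> + M))) + ereal (Gam \<gamma>)))))"

definition is_solution ::
  "(real \<Rightarrow> real) \<Rightarrow> (real \<Rightarrow> real) \<Rightarrow> (real \<Rightarrow> real) \<Rightarrow> real set \<Rightarrow> real set \<Rightarrow> real \<Rightarrow> (real \<Rightarrow> real) \<Rightarrow> bool"
  where
  "is_solution h f \<gamma> I J d \<psi> \<longleftrightarrow>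
     (\<exists>\<psi>' \<psi>''.
        (\<forall>t. (\<psi> has_real_derivative \<psi>' t) (at t)) \<and>
        (\<forall>t. (\<psi>' has_real_derivative \<psi>'' t) (at t)) \<and>
        continuous_on UNIV \<psi>'' \<and>
        (\<forall>t. (\<psi>' t)\<^sup>2 / 2 - primitive f (\<psi> t) - d \<in> J) \<and>
        (\<forall>t. \<psi>'' t = f (\<psi> t) + \<gamma> t * h (Hinv h I ((\<psi>' t)\<^sup>2 / 2 - primitive f (\<psi> t) - d))))"

end

theory Submission
  imports Defs "HOL-Complex_Analysis.Great_Picard"
begin

text \<open>Writing \<open>z = H\<^sup>-\<^sup>1(\<psi>'\<^sup>2/2 - F(\<psi>) - d)\<close>, every solution satisfies \<open>z' = \<gamma> \<psi>'\<close>, while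
  \<open>\<psi>'\<^sup>2/2 = H(z) + F(\<psi>) + d \<le> g(\<bar>z\<bar>) + M + \<bar>d\<bar>\<close>; hence
  \<open>\<bar>z'\<bar> \<le> \<bar>\<gamma>\<bar> (sqrt (2 g(\<bar>z\<bar>)) + sqrt (2 (M + \<bar>d\<bar>)))\<close>. At a zero of \<open>\<psi>'\<close>, which exists in every
  period, \<open>\<bar>z\<bar> \<le> N\<close>, and Bihari's inequality gives \<open>G(\<bar>z\<bar>) \<le> G(N + \<Gamma> sqrt (2 (M + \<bar>d\<bar>))) + \<Gamma>\<close>, that is
  \<open>\<psi>'\<^sup>2/2 - F(\<psi>) - d \<le> -d + M + M\<^sub>1\<^sup>2/2\<close>. Therefore the right-hand side may be replaced by a
  bounded continuous one with the same symmetries, and a continuity argument shows that the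
  solutions of the modified equation solve the original one.

  For a bounded right-hand side, an odd periodic solution is a solution of the Dirichlet problem
  on \<open>[0, 1/2]\<close>. Initial value problems need not be uniquely solvable, so the shooting
  method is applied to equations with a small delay (Tonelli's method), whose solutions depend
  continuously on the initial slope; the delay is then removed by compactness.\<close>

section \<open>Primitives\<close>

lemma primitive_0 [simp]: "primitive q 0 = 0"
  by (simp add: primitive_def zero_ereal_def[symmetric])

lemma primitive_deriv:
  assumes "continuous_on UNIV q"
  shows "(primitive q has_real_derivative q t) (at t)"
proof -
  define a where "a = - \<bar>t\<bar> - 1"
  define b where "b = \<bar>t\<bar> + 1"
  have ab: "a < 0" "0 < b" "a < t" "t < b"
    by (auto simp: a_def b_def)
  have "((\<lambda>u. LBINT y=ereal 0..ereal u. q y) has_vector_derivative q t) (at t within {a..b})"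
    using ab by (intro interval_integral_FTC2 continuous_on_subset[OF assms]) auto
  moreover have "primitive q = (\<lambda>u. LBINT y=ereal 0..ereal u. q y)"
    by (auto simp: primitive_def zero_ereal_def)
  ultimately have "(primitive q has_real_derivative q t) (at t within {a..b})"
    by (simp add: has_real_derivative_iff_has_vector_derivative)
  moreover have "at t within {a..b} = at t"
    using ab by (intro at_within_interior) auto
  ultimately show ?thesis
    by simp
qed

lemma primitive_continuous:
  "continuous_on UNIV q \<Longrightarrow> continuous_on A (primitive q)"
  by (meson DERIV_isCont continuous_at_imp_continuous_on primitive_deriv)

lemma primitive_has_integral:
  assumes "continuous_on UNIV q" "a \<le> b"
  shows "(q has_integral (primitive q b - primitive q a)) {a..b}"
  using primitive_deriv[OF assms(1)] assms(2)
  by (intro fundamental_theorem_of_calculus)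
     (auto simp: has_real_derivative_iff_has_vector_derivative[symmetric]
           intro: has_field_derivative_at_within)

lemma primitive_eq_integral:
  assumes "continuous_on UNIV q" "0 \<le> t"
  shows "primitive q t = integral {0..t} q"
  using primitive_has_integral[OF assms] by (simp add: integral_unique)

lemma primitive_cong:
  assumes "continuous_on UNIV q1" "continuous_on UNIV q2" "0 \<le> t"
    and "\<And>u. 0 \<le> u \<Longrightarrow> u \<le> t \<Longrightarrow> q1 u = q2 u"
  shows "primitive q1 t = primitive q2 t"
  using assms integral_cong[of "{0..t}" q1 q2] by (simp add: primitive_eq_integral)

lemma primitive_lipschitz:
  assumes "continuous_on UNIV q" "convex X" "\<And>u. u \<in> X \<Longrightarrow> \<bar>q u\<bar> \<le> B" "s \<in> X" "t \<in> X"
  shows "\<bar>primitive q s - primitive q t\<bar> \<le> B * \<bar>s - t\<bar>"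
  using field_differentiable_bound[of X "primitive q" q B s t] assms primitive_deriv[OF assms(1)]
  by (auto intro: has_field_derivative_at_within)

lemma DERIV_eq_imp_eq:
  fixes u v :: "real \<Rightarrow> real"
  assumes "\<And>t. (u has_real_derivative w t) (at t)" "\<And>t. (v has_real_derivative w t) (at t)"
    and "u a = v a"
  shows "u t = v t"
proof -
  have "((\<lambda>t. u t - v t) has_real_derivative 0) (at t)" for t
    using DERIV_diff[OF assms(1)[of t] assms(2)[of t]] by simp
  then have "u t - v t = u a - v a"
    by (intro DERIV_isconst_all) auto
  with assms(3) show ?thesis by simp
qed

text \<open>The substitution \<open>u = t * r\<close> moves the variable endpoint into the
  integrand, which leaves a parametric integral over the fixed interval from 0 to 1.\<close>

lemma primitive_joint_continuous:
  fixes q :: "'a::topological_space \<Rightarrow> real \<Rightarrow> real"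
  assumes q: "continuous_on UNIV (\<lambda>(s, t). q s t)"
  shows "continuous_on UNIV (\<lambda>(s, t). primitive (q s) t)"
proof -
  have qs: "continuous_on UNIV (q s)" for s
    using continuous_on_compose2[OF q, of UNIV "\<lambda>t. (s, t)"] by (simp add: continuous_on_Pair)
  have eq: "primitive (q s) t = t * integral (cbox 0 1) (\<lambda>r. q s (t * r))" for s t
  proof -
    have "((\<lambda>r. primitive (q s) (t * r)) has_vector_derivative t * q s (t * r)) (at r within {0..1})" for r
      unfolding has_real_derivative_iff_has_vector_derivative[symmetric]
      by (rule DERIV_subset[of _ _ _ UNIV], rule DERIV_chain2[OF primitive_deriv[OF qs], THEN DERIV_cong])
         (auto intro!: derivative_eq_intros)
    then have "((\<lambda>r. t * q s (t * r)) has_integral (primitive (q s) (t * 1) - primitive (q s) (t * 0))) {0..1}"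
      by (intro fundamental_theorem_of_calculus) auto
    then have "integral {0..1} (\<lambda>r. t * q s (t * r)) = primitive (q s) t"
      by (simp only: integral_unique mult_1_right mult_zero_right primitive_0 diff_zero)
    then show ?thesis by simp
  qed
  have "continuous_on UNIV (\<lambda>x. integral (cbox 0 1) (\<lambda>r. q (fst x) (snd x * r)))"
  proof (rule integral_continuous_on_param)
    have "continuous_on (UNIV \<times> cbox 0 1) (\<lambda>y. (\<lambda>(s, t). q s t) (fst (fst y), snd (fst y) * snd y))"
      by (rule continuous_on_compose2[OF q]) (auto intro!: continuous_intros)
    then show "continuous_on (UNIV \<times> cbox 0 1) (\<lambda>(x, r). q (fst x) (snd x * r))"
      by (simp add: case_prod_beta)
  qed
  then show ?thesis
    by (auto simp: eq case_prod_beta intro!: continuous_intros)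
qed

section \<open>The Dirichlet problem with a bounded right-hand side\<close>

text \<open>Successive approximations to the slope \<open>p = x'\<close> in the delayed problem
  \<open>x''(t) = \<Phi> (t, x (t - \<delta>), p (t - \<delta>))\<close>, \<open>x 0 = 0\<close>,
  \<open>p 0 = s\<close>. The position is recovered as the primitive of the slope, and
  \<open>max 0\<close> freezes the history at time 0.\<close>

primrec delayed_iterate :: "(real \<times> real \<times> real \<Rightarrow> real) \<Rightarrow> real \<Rightarrow> nat \<Rightarrow> real \<Rightarrow> real \<Rightarrow> real" where
  "delayed_iterate \<Phi> \<delta> 0 s = (\<lambda>t. s)"
| "delayed_iterate \<Phi> \<delta> (Suc j) s = (\<lambda>t. s + primitive (\<lambda>r. \<Phi> (r,
     primitive (delayed_iterate \<Phi> \<delta> j s) (max 0 (r - \<delta>)), delayed_iterate \<Phi> \<delta> j s (max 0 (r - \<delta>)))) t)"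

text \<open>Including the slope \<open>s\<close> among the variables makes the endpoint reached by
  shooting a continuous function of \<open>s\<close>.\<close>

lemma delayed_iterate_joint_continuous:
  assumes \<Phi>: "continuous_on UNIV \<Phi>"
  shows "continuous_on UNIV (\<lambda>(s, t). delayed_iterate \<Phi> \<delta> j s t)"
proof (induction j)
  case (Suc j)
  let ?P = "delayed_iterate \<Phi> \<delta> j"
  have m: "continuous_on UNIV (\<lambda>y. (fst y, max 0 (snd y - \<delta>)))"
    by (intro continuous_intros)
  have 1: "continuous_on UNIV (\<lambda>y. ?P (fst y) (max 0 (snd y - \<delta>)))"
    using continuous_on_compose2[OF Suc m] by (simp add: case_prod_beta)
  have 2: "continuous_on UNIV (\<lambda>y. primitive (?P (fst y)) (max 0 (snd y - \<delta>)))"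
    using continuous_on_compose2[OF primitive_joint_continuous[OF Suc] m] by (simp add: case_prod_beta)
  have "continuous_on UNIV (\<lambda>y. \<Phi> (snd y, primitive (?P (fst y)) (max 0 (snd y - \<delta>)), ?P (fst y) (max 0 (snd y - \<delta>))))"
    by (rule continuous_on_compose2[OF \<Phi>]) (auto intro!: continuous_intros 1 2)
  then have "continuous_on UNIV (\<lambda>(s, r). \<Phi> (r, primitive (?P s) (max 0 (r - \<delta>)), ?P s (max 0 (r - \<delta>))))"
    by (simp add: case_prod_beta)
  from primitive_joint_continuous[OF this] show ?case
    by (auto simp: case_prod_beta intro!: continuous_intros)
qed (auto simp: case_prod_beta intro!: continuous_intros)

lemma delayed_iterate_continuous:
  assumes "continuous_on UNIV \<Phi>"
  shows "continuous_on A (delayed_iterate \<Phi> \<delta> j s)"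
  using continuous_on_compose2[OF delayed_iterate_joint_continuous[OF assms], of A "\<lambda>t. (s, t)"]
  by (simp add: continuous_on_Pair)

lemma delayed_integrand_continuous:
  fixes \<Phi> :: "real \<times> real \<times> real \<Rightarrow> real"
  assumes "continuous_on UNIV \<Phi>" "continuous_on UNIV p"
  shows "continuous_on UNIV (\<lambda>r. \<Phi> (r, primitive p (max 0 (r - \<delta>)), p (max 0 (r - \<delta>))))"
  by (rule continuous_on_compose2[OF assms(1)])
     (auto intro!: continuous_intros continuous_on_compose2[OF assms(2)]
        continuous_on_compose2[OF primitive_continuous[OF assms(2), of UNIV]])

text \<open>Method of steps: on \<open>{0..t}\<close> the next iterate only consults the previous
  one up to time \<open>t - \<delta>\<close>, so each iteration lengthens the interval of agreement
  by \<open>\<delta>\<close>, starting from the single point 0.\<close>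

lemma delayed_iterate_stable:
  assumes \<Phi>: "continuous_on UNIV \<Phi>" and \<delta>: "0 \<le> \<delta>" and t: "0 \<le> t" "t \<le> real j * \<delta>"
  shows "delayed_iterate \<Phi> \<delta> (Suc j) s t = delayed_iterate \<Phi> \<delta> j s t"
  using t
proof (induction j arbitrary: t)
  case (Suc j)
  define p where "p = delayed_iterate \<Phi> \<delta> j s"
  define p' where "p' = delayed_iterate \<Phi> \<delta> (Suc j) s"
  have cont: "continuous_on UNIV p" "continuous_on UNIV p'"
    unfolding p_def p'_def by (intro delayed_iterate_continuous[OF \<Phi>])+
  have eq: "p' u = p u" if "0 \<le> u" "u \<le> real j * \<delta>" for u
    using Suc.IH that unfolding p_def p'_def by blast
  have eq': "primitive p' u = primitive p u" if "0 \<le> u" "u \<le> real j * \<delta>" for u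
    using that by (intro primitive_cong cont eq) auto
  have le: "max 0 (r - \<delta>) \<le> real j * \<delta>" if "r \<le> t" for r
    using that \<delta> Suc.prems by (auto simp: algebra_simps)
  have "delayed_iterate \<Phi> \<delta> (Suc (Suc j)) s t =
      s + primitive (\<lambda>r. \<Phi> (r, primitive p' (max 0 (r - \<delta>)), p' (max 0 (r - \<delta>)))) t"
    by (simp add: p'_def)
  also have "\<dots> = s + primitive (\<lambda>r. \<Phi> (r, primitive p (max 0 (r - \<delta>)), p (max 0 (r - \<delta>)))) t"
    using Suc.prems
    by (intro arg_cong[where f = "\<lambda>x. s + x"] primitive_cong delayed_integrand_continuous[OF \<Phi>] cont)
       (auto simp: eq[OF _ le] eq'[OF _ le])
  also have "\<dots> = delayed_iterate \<Phi> \<delta> (Suc j) s t"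
    by (simp add: p_def)
  finally show ?case .
qed simp

text \<open>The slope changes by at most \<open>B\<close> up to time \<open>1/2\<close>, so the
  initial slopes \<open>- B\<close> and \<open>B\<close> end on opposite sides of 0, and the
  intermediate value theorem supplies a slope that hits 0.\<close>

lemma delayed_shooting:
  fixes \<Phi> :: "real \<times> real \<times> real \<Rightarrow> real" and n :: nat
  assumes \<Phi>: "continuous_on UNIV \<Phi>" and B: "\<And>x. \<bar>\<Phi> x\<bar> \<le> B"
  defines "\<delta> \<equiv> 1 / real (Suc n)"
  shows "\<exists>s p. \<bar>s\<bar> \<le> B \<and> continuous_on UNIV p \<and> primitive p (1/2) = 0 \<and>
    (\<forall>t\<in>{0..1}. p t = s + primitive (\<lambda>r. \<Phi> (r, primitive p (max 0 (r - \<delta>)), p (max 0 (r - \<delta>)))) t)"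
proof -
  let ?P = "delayed_iterate \<Phi> \<delta> (Suc n)"
  have B0: "0 \<le> B"
    using B[of undefined] by linarith
  have cont: "continuous_on UNIV (\<lambda>s. primitive (?P s) (1/2))"
    using continuous_on_compose2[OF primitive_joint_continuous[OF delayed_iterate_joint_continuous[OF \<Phi>, of \<delta> "Suc n"]],
        of UNIV "\<lambda>s. (s, 1/2)"]
    by (simp add: continuous_on_Pair del: delayed_iterate.simps)
  have contP: "continuous_on A (?P s)" for A s
    by (rule delayed_iterate_continuous[OF \<Phi>])
  have near: "\<bar>?P s t - s\<bar> \<le> B" if "t \<in> {0..1/2}" for s t
  proof -
    let ?q = "\<lambda>r. \<Phi> (r, primitive (delayed_iterate \<Phi> \<delta> n s) (max 0 (r - \<delta>)),
                     delayed_iterate \<Phi> \<delta> n s (max 0 (r - \<delta>)))"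
    have "\<bar>primitive ?q t - primitive ?q 0\<bar> \<le> B * \<bar>t - 0\<bar>"
      by (rule primitive_lipschitz[of _ UNIV])
         (auto intro!: B delayed_integrand_continuous[OF \<Phi>] delayed_iterate_continuous[OF \<Phi>])
    also have "\<dots> \<le> B * 1"
      using that B0 by (intro mult_left_mono) auto
    finally show ?thesis by simp
  qed
  have eqint: "primitive (?P s) (1/2) = integral {0..1/2} (?P s)" for s
    by (rule primitive_eq_integral[OF contP]) simp
  \<comment> \<open>By \<open>near\<close>, a solution with initial slope \<open>- B\<close> has
    slope at most 0 throughout; with initial slope \<open>B\<close> it has slope at least 0.\<close>
  have "integral {0..1/2} (?P (- B)) \<le> integral {0..1/2::real} (\<lambda>_. 0)"
    using near[of _ "- B"] by (intro integral_le integrable_continuous_real contP) (fastforce simp: abs_le_iff)+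
  moreover have "integral {0..1/2::real} (\<lambda>_. 0) \<le> integral {0..1/2} (?P B)"
    using near[of _ B] by (intro integral_le integrable_continuous_real contP) (fastforce simp: abs_le_iff)+
  ultimately have "primitive (?P (- B)) (1/2) \<le> 0" "0 \<le> primitive (?P B) (1/2)"
    by (simp_all only: eqint integral_0)
  then obtain s where s: "- B \<le> s" "s \<le> B" "primitive (?P s) (1/2) = 0"
    using IVT'[of "\<lambda>s. primitive (?P s) (1/2)" "- B" 0 B, OF _ _ _ continuous_on_subset[OF cont]] B0
    by auto
  \<comment> \<open>\<open>Suc n\<close> steps of length \<open>\<delta> = 1 / Suc n\<close> cover
    \<open>{0..1}\<close> exactly, so there the iterate is already a fixed point.\<close>
  have "?P s t = s + primitive (\<lambda>r. \<Phi> (r, primitive (?P s) (max 0 (r - \<delta>)), ?P s (max 0 (r - \<delta>)))) t"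
    if "t \<in> {0..1}" for t
  proof -
    have "delayed_iterate \<Phi> \<delta> (Suc (Suc n)) s t = ?P s t"
      using that by (intro delayed_iterate_stable[OF \<Phi>]) (auto simp: \<delta>_def)
    then show ?thesis
      by (simp only: delayed_iterate.simps(2)[of _ _ "Suc n"])
  qed
  then show ?thesis
    using s contP by (intro exI[of _ s] exI[of _ "?P s"]) (auto simp del: delayed_iterate.simps)
qed

text \<open>On \<open>{0..1/2}\<close> the slopes of the delayed solutions share the bound
  \<open>2 * B\<close> and the Lipschitz constant \<open>B\<close>. Arzela-Ascoli gives a uniform
  limit along a subsequence, and the delay disappears in it. The condition at 0 is built in, since
  the position is \<open>primitive p\<close>.\<close>

lemma dirichlet_first_order_system:
  fixes \<Phi> :: "real \<times> real \<times> real \<Rightarrow> real"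
  assumes \<Phi>: "continuous_on UNIV \<Phi>" and B: "\<And>x. \<bar>\<Phi> x\<bar> \<le> B"
  shows "\<exists>p. continuous_on UNIV p \<and> primitive p (1/2) = 0 \<and>
    (\<forall>t\<in>{0..1/2}. p t = p 0 + primitive (\<lambda>r. \<Phi> (r, primitive p r, p r)) t)"
proof -
  define \<delta> where "\<delta> n = 1 / real (Suc n)" for n
  define Q where "Q n s p \<longleftrightarrow> \<bar>s\<bar> \<le> B \<and> continuous_on UNIV p \<and> primitive p (1/2) = 0 \<and>
      (\<forall>t\<in>{0..1}. p t = s + primitive (\<lambda>r. \<Phi> (r, primitive p (max 0 (r - \<delta> n)), p (max 0 (r - \<delta> n)))) t)"
    for n s p
  have "\<forall>n. \<exists>s p. Q n s p"
    unfolding Q_def \<delta>_def by (intro allI delayed_shooting[OF \<Phi> B])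
  then obtain s p where Q: "\<And>n. Q n (s n) (p n)"
    by metis
  then have s: "\<And>n. \<bar>s n\<bar> \<le> B" and p_cont: "\<And>n. continuous_on UNIV (p n)"
    and p_zero: "\<And>n. primitive (p n) (1/2) = 0"
    and p_eq: "\<And>n t. t \<in> {0..1} \<Longrightarrow> p n t = s n + primitive (\<lambda>r. \<Phi> (r, primitive (p n) (max 0 (r - \<delta> n)), p n (max 0 (r - \<delta> n)))) t"
    by (simp_all only: Q_def)
  let ?q = "\<lambda>n r. \<Phi> (r, primitive (p n) (max 0 (r - \<delta> n)), p n (max 0 (r - \<delta> n)))"
  define I where "I = {0..1/2::real}"
  have B0: "0 \<le> B"
    using s[of 0] by linarith
  have q_cont: "continuous_on A (?q n)" for n A
    using delayed_integrand_continuous[OF \<Phi> p_cont] continuous_on_subset by blast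
  have p_0: "p n 0 = s n" for n
    using p_eq[of 0] by simp
  have p_lip: "\<bar>p n t - p n u\<bar> \<le> B * \<bar>t - u\<bar>" if "t \<in> I" "u \<in> I" for n t u
    using primitive_lipschitz[of "?q n" UNIV B t u] that q_cont B by (simp add: p_eq I_def)
  have p_bound: "\<bar>p n t\<bar> \<le> 2 * B" if "t \<in> I" for n t
  proof -
    have "B * \<bar>t\<bar> \<le> B * 1"
      using that B0 by (intro mult_left_mono) (auto simp: I_def)
    then show ?thesis
      using p_lip[OF that, of 0 n] s[of n] p_0[of n] by (auto simp: I_def)
  qed
  have P_lip: "\<bar>primitive (p n) t - primitive (p n) u\<bar> \<le> 2 * B * \<bar>t - u\<bar>" if "t \<in> I" "u \<in> I" for n t u
    using that by (intro primitive_lipschitz[of _ I] p_cont p_bound) (auto simp: I_def)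
  obtain v k where v: "continuous_on I v" and k: "strict_mono (k :: nat \<Rightarrow> nat)"
    and lim: "\<And>e. 0 < e \<Longrightarrow> \<exists>N. \<forall>n x. n \<ge> N \<and> x \<in> I \<longrightarrow> norm (p (k n) x - v x) < e"
  proof (rule Arzela_Ascoli[of I p "2 * B"])
    show "\<exists>d>0. \<forall>n y. y \<in> I \<and> norm (x - y) < d \<longrightarrow> norm (p n x - p n y) < e" if "x \<in> I" "0 < e" for x e
    \<comment> \<open>Dividing by \<open>B + 1\<close> instead of \<open>B\<close> covers
      \<open>B = 0\<close>.\<close>
    proof (intro exI[of _ "e / (B + 1)"] conjI allI impI)
      fix n y assume y: "y \<in> I \<and> norm (x - y) < e / (B + 1)"
      have "B * \<bar>x - y\<bar> \<le> (B + 1) * \<bar>x - y\<bar>"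
        by (simp add: mult_right_mono)
      also have "\<dots> < e"
        using y B0 by (simp add: field_simps)
      finally show "norm (p n x - p n y) < e"
        using p_lip[OF \<open>x \<in> I\<close>, of y n] y by simp
    qed (use B0 that in auto)
  qed (use p_bound in \<open>auto simp: I_def\<close>)
  \<comment> \<open>Clamping time extends the limit continuously to the whole line, as the facts
    about \<open>primitive\<close> require.\<close>
  define c where "c t = max 0 (min t (1/2))" for t :: real
  define w where "w t = v (c t)" for t
  have c_in: "c t \<in> I" for t by (auto simp: c_def I_def)
  have w_eq: "w t = v t" if "t \<in> I" for t
    using that by (auto simp: w_def c_def I_def)
  have w_cont: "continuous_on A w" for A
    unfolding w_def by (rule continuous_on_compose2[OF v]) (use c_in in \<open>auto simp: c_def intro!: continuous_intros\<close>)
  have \<delta>_lim: "(\<lambda>n. \<delta> (k n)) \<longlonglongrightarrow> 0"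
    using LIMSEQ_subseq_LIMSEQ[OF _ k, of "\<lambda>n. 1 / real (Suc n)" 0] LIMSEQ_inverse_real_of_nat
    by (simp add: \<delta>_def[abs_def] o_def divide_inverse)
  have \<delta>0: "0 < \<delta> n" for n by (simp add: \<delta>_def)
  have delay_in: "max 0 (t - \<delta> n) \<in> I" and delay_near: "\<bar>max 0 (t - \<delta> n) - t\<bar> \<le> \<delta> n" if "t \<in> I" for t n
    using that \<delta>0[of n] by (auto simp: I_def max_def)
  have p_lim: "(\<lambda>n. p (k n) t) \<longlonglongrightarrow> w t" if "t \<in> I" for t
    unfolding w_eq[OF that] lim_sequentially dist_norm using lim that by blast
  have P_lim: "(\<lambda>n. primitive (p (k n)) t) \<longlonglongrightarrow> primitive w t" if "t \<in> I" for t
  proof -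
    have "(\<lambda>n. integral {0..t} (p (k n))) \<longlonglongrightarrow> integral {0..t} w"
    proof (rule dominated_convergence(2)[where h = "\<lambda>_. 2 * B"])
      show "p (k n) integrable_on {0..t}" for n
        by (intro integrable_continuous_real continuous_on_subset[OF p_cont]) auto
    qed (use that p_bound p_lim in \<open>auto simp: I_def\<close>)
    then show ?thesis
      using that by (simp add: primitive_eq_integral p_cont w_cont I_def)
  qed
  \<comment> \<open>The Lipschitz constants do not depend on \<open>n\<close>, so delaying the
    argument by \<open>\<delta> (k n)\<close> alters the values by a null sequence; the same holds
    for the positions below.\<close>
  have p_lim': "(\<lambda>n. p (k n) (max 0 (t - \<delta> (k n)))) \<longlonglongrightarrow> w t" if "t \<in> I" for t
  proof (rule Lim_transform[OF p_lim[OF that]])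
    show "(\<lambda>n. p (k n) (max 0 (t - \<delta> (k n))) - p (k n) t) \<longlonglongrightarrow> 0"
    proof (rule Lim_null_comparison[OF _ tendsto_mult_right_zero[OF \<delta>_lim, of B]])
      have "\<bar>p (k n) (max 0 (t - \<delta> (k n))) - p (k n) t\<bar> \<le> B * \<delta> (k n)" for n
        using p_lip[OF delay_in[OF that] that, of "k n" "k n"]
          mult_left_mono[OF delay_near[OF that, of "k n"] B0]
        by linarith
      then show "\<forall>\<^sub>F n in sequentially. norm (p (k n) (max 0 (t - \<delta> (k n))) - p (k n) t) \<le> B * \<delta> (k n)"
        by simp
    qed
  qed
  have P_lim': "(\<lambda>n. primitive (p (k n)) (max 0 (t - \<delta> (k n)))) \<longlonglongrightarrow> primitive w t" if "t \<in> I" for t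
  proof (rule Lim_transform[OF P_lim[OF that]])
    show "(\<lambda>n. primitive (p (k n)) (max 0 (t - \<delta> (k n))) - primitive (p (k n)) t) \<longlonglongrightarrow> 0"
    proof (rule Lim_null_comparison[OF _ tendsto_mult_right_zero[OF \<delta>_lim, of "2 * B"]])
      have "\<bar>primitive (p (k n)) (max 0 (t - \<delta> (k n))) - primitive (p (k n)) t\<bar> \<le> 2 * B * \<delta> (k n)" for n
        using P_lip[OF delay_in[OF that] that, of "k n" "k n"]
          mult_left_mono[OF delay_near[OF that, of "k n"], of "2 * B"] B0
        by linarith
      then show "\<forall>\<^sub>F n in sequentially. norm (primitive (p (k n)) (max 0 (t - \<delta> (k n))) - primitive (p (k n)) t) \<le> 2 * B * \<delta> (k n)"
        by simp
    qed
  qed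
  have rhs_cont: "continuous_on A (\<lambda>r. \<Phi> (r, primitive w r, w r))" for A
    by (rule continuous_on_compose2[OF \<Phi>]) (auto intro!: continuous_intros primitive_continuous w_cont)
  \<comment> \<open>The integrands converge pointwise by continuity of \<open>\<Phi>\<close> and are
    dominated by the constant \<open>B\<close>, so the integral equation passes to the
    limit.\<close>
  have w_eqn: "w t = w 0 + primitive (\<lambda>r. \<Phi> (r, primitive w r, w r)) t" if t: "t \<in> I" for t
  proof -
    have "(\<lambda>n. integral {0..t} (?q (k n))) \<longlonglongrightarrow> integral {0..t} (\<lambda>r. \<Phi> (r, primitive w r, w r))"
    proof (rule dominated_convergence(2)[where h = "\<lambda>_. B"])
      show "?q (k n) integrable_on {0..t}" for n
        by (intro integrable_continuous_real q_cont)
      fix r assume "r \<in> {0..t}"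
      then have r: "r \<in> I" using t by (auto simp: I_def)
      have "isCont \<Phi> (r, primitive w r, w r)"
        using \<Phi> by (simp add: continuous_on_eq_continuous_at)
      then show "(\<lambda>n. ?q (k n) r) \<longlonglongrightarrow> \<Phi> (r, primitive w r, w r)"
        by (rule isCont_tendsto_compose) (intro tendsto_intros p_lim' P_lim' r)
    qed (use B in auto)
    then have "(\<lambda>n. primitive (?q (k n)) t) \<longlonglongrightarrow> primitive (\<lambda>r. \<Phi> (r, primitive w r, w r)) t"
      using t by (simp add: primitive_eq_integral q_cont rhs_cont I_def)
    moreover have "(\<lambda>n. p (k n) 0) \<longlonglongrightarrow> w 0"
      by (rule p_lim) (simp add: I_def)
    ultimately have "(\<lambda>n. p (k n) 0 + primitive (?q (k n)) t) \<longlonglongrightarrow> w 0 + primitive (\<lambda>r. \<Phi> (r, primitive w r, w r)) t"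
      by (rule tendsto_add[rotated])
    moreover have "p (k n) 0 + primitive (?q (k n)) t = p (k n) t" for n
      using p_eq[of t "k n"] t by (simp add: p_0 I_def)
    ultimately show ?thesis
      using p_lim[OF t] LIMSEQ_unique by auto
  qed
  show ?thesis
  proof (intro exI[of _ w] conjI ballI)
    show "primitive w (1/2) = 0"
      using P_lim[of "1/2"] by (simp add: p_zero I_def LIMSEQ_const_iff)
  qed (unfold I_def[symmetric], (rule w_cont w_eqn, assumption?)+)
qed

section \<open>Odd periodic solutions\<close>

lemma primitive_compose_deriv:
  assumes "continuous_on UNIV q" "(v has_real_derivative v') (at t)"
  shows "((\<lambda>t. primitive q (v t)) has_real_derivative q (v t) * v') (at t)"
  by (rule DERIV_chain2[where f = "primitive q" and g = v and x = t, OF primitive_deriv[OF assms(1)] assms(2)])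

lemma primitive_odd:
  assumes q: "continuous_on UNIV q" and even: "\<And>t. q (- t) = q t"
  shows "primitive q (- t) = - primitive q t"
proof -
  have "((\<lambda>t. primitive q (- t)) has_real_derivative - q t) (at t)" for t
    using primitive_compose_deriv[OF q, of uminus "- 1" t] DERIV_minus[OF DERIV_ident, of t] by (simp add: even)
  moreover have "((\<lambda>t. - primitive q t) has_real_derivative - q t) (at t)" for t
    by (intro DERIV_minus primitive_deriv[OF q])
  ultimately show ?thesis
    using DERIV_eq_imp_eq[of "\<lambda>t. primitive q (- t)" "\<lambda>t. - q t" "\<lambda>t. - primitive q t" 0 t] by simp
qed

lemma primitive_even:
  assumes q: "continuous_on UNIV q" and odd: "\<And>t. q (- t) = - q t"
  shows "primitive q (- t) = primitive q t"
proof -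
  have "((\<lambda>t. primitive q (- t)) has_real_derivative q t) (at t)" for t
    using primitive_compose_deriv[OF q, of uminus "- 1" t] DERIV_minus[OF DERIV_ident, of t] by (simp add: odd)
  then show ?thesis
    using DERIV_eq_imp_eq[of "\<lambda>t. primitive q (- t)" q "primitive q" 0 t] primitive_deriv[OF q] by simp
qed

text \<open>The increment over one period is the same from every base point. Keeping
  \<open>a\<close> free allows the choice \<open>a = - 1/2\<close>, where parity evaluates the
  increment.\<close>

lemma primitive_shift:
  assumes q: "continuous_on UNIV q" and per: "\<And>t. q (t + 1) = q t"
  shows "primitive q (t + 1) = primitive q t + (primitive q (a + 1) - primitive q a)"
proof -
  let ?v = "\<lambda>t. primitive q t + (primitive q (a + 1) - primitive q a)"
  have "((\<lambda>t. primitive q (t + 1)) has_real_derivative q t) (at t)" for t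
    using primitive_compose_deriv[OF q DERIV_add[OF DERIV_ident DERIV_const], of 1 t] by (simp add: per)
  moreover have "(?v has_real_derivative q t) (at t)" for t
    using DERIV_add[OF primitive_deriv[OF q] DERIV_const] by simp
  ultimately show ?thesis
    using DERIV_eq_imp_eq[of "\<lambda>t. primitive q (t + 1)" q ?v a t] by simp
qed

lemma one_periodic_add_int:
  assumes "one_periodic u"
  shows "u (t + of_int n) = u t"
proof (induction n arbitrary: t rule: int_induct[where k = 0])
  case (step1 i)
  have "u (t + of_int (i + 1)) = u ((t + of_int i) + 1)"
    by (simp add: algebra_simps)
  then show ?case
    using assms step1 by (simp add: one_periodic_def)
next
  case (step2 i)
  have "u (t + of_int (i - 1)) = u ((t + of_int (i - 1)) + 1)"
    using assms unfolding one_periodic_def by metis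
  also have "(t + of_int (i - 1)) + 1 = t + of_int i"
    by simp
  finally show ?case
    using step2 by simp
qed simp

text \<open>Translations by integers and reflection fold the line onto \<open>{0..1/2}\<close>, so
  identities between even periodic functions need checking only there.\<close>

lemma one_periodic_even_eq:
  assumes "one_periodic u" "\<And>t. u (- t) = u t"
  shows "u t = u \<bar>t - of_int (round t)\<bar>"
proof -
  have "u t = u (t - of_int (round t))"
    using one_periodic_add_int[OF assms(1), of "t - of_int (round t)" "round t"] by simp
  then show ?thesis
    using assms(2)[of "t - of_int (round t)"] by (simp add: abs_if)
qed

lemma one_periodic_bounded:
  fixes u :: "real \<Rightarrow> real"
  assumes "one_periodic u" "continuous_on UNIV u"
  obtains b where "\<And>t. \<bar>u t\<bar> \<le> b"
proof -
  have "compact (u ` {0..1})"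
    by (intro compact_continuous_image continuous_on_subset[OF assms(2)]) auto
  then obtain b where b: "\<And>t. t \<in> {0..1} \<Longrightarrow> \<bar>u t\<bar> \<le> b"
    using compact_imp_bounded[THEN bounded_iff[THEN iffD1]] by force
  have "\<bar>u t\<bar> \<le> b" for t
    using b[of "frac t"] one_periodic_add_int[OF assms(1), of "frac t" "\<lfloor>t\<rfloor>"] frac_lt_1[of t]
    by (simp add: frac_def)
  then show ?thesis by (rule that)
qed

text \<open>The slope of the Dirichlet solution is extended evenly and periodically. The symmetries
  of \<open>\<Phi>\<close> then carry the integrated equation from \<open>{0..1/2}\<close> to the
  whole line.\<close>

lemma odd_periodic_solution:
  fixes \<Phi> :: "real \<times> real \<times> real \<Rightarrow> real"
  assumes \<Phi>: "continuous_on UNIV \<Phi>" and B: "\<And>x. \<bar>\<Phi> x\<bar> \<le> B"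
    and odd: "\<And>t x p. \<Phi> (- t, - x, p) = - \<Phi> (t, x, p)"
    and per: "\<And>t x p. \<Phi> (t + 1, x, p) = \<Phi> (t, x, p)"
  shows "\<exists>\<psi> p. (\<forall>t. (\<psi> has_real_derivative p t) (at t)) \<and>
    (\<forall>t. (p has_real_derivative \<Phi> (t, \<psi> t, p t)) (at t)) \<and> odd_fun \<psi> \<and> one_periodic \<psi>"
proof -
  obtain p0 where p0: "continuous_on UNIV p0" "primitive p0 (1/2) = 0"
    and p0_eq: "\<And>t. t \<in> {0..1/2} \<Longrightarrow> p0 t = p0 0 + primitive (\<lambda>r. \<Phi> (r, primitive p0 r, p0 r)) t"
    using dirichlet_first_order_system[OF \<Phi> B] by blast
  \<comment> \<open>The distance from \<open>t\<close> to the nearest integer, in a form whose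
    continuity, evenness and periodicity are inherited from the cosine.\<close>
  define \<sigma> where "\<sigma> t = arccos (cos (2 * pi * t)) / (2 * pi)" for t
  have \<sigma>_id: "\<sigma> t = t" if "t \<in> {0..1/2}" for t
    using that by (simp add: \<sigma>_def arccos_cos)
  have \<sigma>_cont: "continuous_on UNIV \<sigma>"
    unfolding \<sigma>_def by (intro continuous_intros continuous_on_arccos) auto
  define p where "p t = p0 (\<sigma> t)" for t
  define \<psi> where "\<psi> = primitive p"
  define w where "w t = \<Phi> (t, \<psi> t, p t)" for t
  have p_cont: "continuous_on UNIV p"
    unfolding p_def by (rule continuous_on_compose2[OF p0(1) \<sigma>_cont]) auto
  have p_even: "p (- t) = p t" and p_per: "p (t + 1) = p t" for t
    by (simp_all add: p_def \<sigma>_def distrib_left)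
  have p_eq: "p t = p0 t" if "t \<in> {0..1/2}" for t
    using that by (simp add: p_def \<sigma>_id)
  have \<psi>_eq: "\<psi> t = primitive p0 t" if "t \<in> {0..1/2}" for t
    unfolding \<psi>_def using that by (intro primitive_cong p_cont p0 p_eq) auto
  have \<psi>_odd: "\<psi> (- t) = - \<psi> t" for t
    unfolding \<psi>_def by (rule primitive_odd[OF p_cont p_even])
  \<comment> \<open>By oddness the increment from \<open>- 1/2\<close> to \<open>1/2\<close> is
    twice \<open>\<psi> (1/2)\<close>, which the boundary condition makes 0.\<close>
  have \<psi>_per: "\<psi> (t + 1) = \<psi> t" for t
    using primitive_shift[of p t "- 1/2", OF p_cont p_per] \<psi>_odd[of "1/2"] \<psi>_eq[of "1/2"] p0(2)
    by (simp add: \<psi>_def)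
  have w_cont: "continuous_on UNIV w"
    unfolding w_def \<psi>_def
    by (rule continuous_on_compose2[OF \<Phi>]) (auto intro!: continuous_intros primitive_continuous p_cont)
  have w_odd: "w (- t) = - w t" for t
    by (simp add: w_def p_even \<psi>_odd odd)
  have w_per: "w (t + 1) = w t" for t
    by (simp add: w_def p_per \<psi>_per per)
  have W_even: "primitive w (- t) = primitive w t" for t
    by (rule primitive_even[OF w_cont w_odd])
  have W_per: "primitive w (t + 1) = primitive w t" for t
    using primitive_shift[of w t "- 1/2", OF w_cont w_per] W_even[of "1/2"] by simp
  \<comment> \<open>The defect in the integrated equation: it is even and periodic, so it vanishes
    everywhere once it vanishes on \<open>{0..1/2}\<close>.\<close>
  define D where "D t = p t - p 0 - primitive w t" for t
  have "D t = 0" if t: "t \<in> {0..1/2}" for t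
  proof -
    have "primitive w t = primitive (\<lambda>r. \<Phi> (r, primitive p0 r, p0 r)) t"
    proof (rule primitive_cong[OF w_cont])
      show "continuous_on UNIV (\<lambda>r. \<Phi> (r, primitive p0 r, p0 r))"
        by (rule continuous_on_compose2[OF \<Phi>]) (auto intro!: continuous_intros primitive_continuous p0)
    qed (use t in \<open>auto simp: w_def p_eq \<psi>_eq\<close>)
    then show ?thesis
      using p0_eq[OF t] t by (simp add: D_def p_eq)
  qed
  moreover have "one_periodic D" "\<And>t. D (- t) = D t"
    by (simp_all add: one_periodic_def D_def p_per W_per p_even W_even)
  ultimately have D0: "D t = 0" for t
    using one_periodic_even_eq[of D t] of_int_round_abs_le[of t] by (simp add: abs_minus_commute)
  define c where "c = p 0"
  have "p = (\<lambda>t. c + primitive w t)"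
    using D0 unfolding D_def c_def[symmetric] by (intro ext) (simp add: diff_eq_eq)
  moreover have "((\<lambda>t. c + primitive w t) has_real_derivative w t) (at t)" for t
    using DERIV_add[OF DERIV_const primitive_deriv[OF w_cont]] by simp
  ultimately have "(p has_real_derivative w t) (at t)" for t
    by (simp only:)
  then show ?thesis
    using primitive_deriv[OF p_cont] \<psi>_odd \<psi>_per
    by (intro exI[of _ \<psi>] exI[of _ p]) (auto simp: w_def odd_fun_def one_periodic_def \<psi>_def)
qed

section \<open>Bihari's inequality\<close>

locale growth_function =
  fixes g :: "real \<Rightarrow> real"
  assumes g_cont: "continuous_on {0..} g"
    and g_mono: "mono_on {0..} g"
    and g_nonneg: "\<And>r. r \<ge> 0 \<Longrightarrow> g r \<ge> 0"
    and g_pos: "\<And>r. r > 0 \<Longrightarrow> g r > 0"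
begin

text \<open>The integrand of \<open>G\<close>, extended to negative arguments by its value at 0;
  that value is 0 if \<open>g 0 = 0\<close>, by division by zero.\<close>

definition rate :: "real \<Rightarrow> real" where
  "rate u = 1 / sqrt (2 * g (max 0 u))"

text \<open>Regarding integrals of \<open>rate\<close> as measures of sets makes continuity from
  below available at 0 and at infinity, where they may diverge.\<close>

definition rate_measure :: "real measure" where
  "rate_measure = density lborel (\<lambda>u. ennreal (rate u))"

text \<open>An antiderivative on the open half-line only, because the integral may diverge at 0. It
  is not normalised: \<open>G_fun g x\<close> is its increment from 1 to \<open>x\<close> for
  positive \<open>x\<close>.\<close>

definition rate_primitive :: "real \<Rightarrow> real" where
  "rate_primitive = (SOME P. \<forall>x>0. (P has_real_derivative rate x) (at x))"

lemma g_max_cont: "continuous_on A (\<lambda>u. g (max 0 u))"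
  by (rule continuous_on_compose2[OF g_cont]) (auto intro!: continuous_intros)

lemma rate_measurable [measurable]: "rate \<in> borel_measurable borel"
proof -
  have [measurable]: "(\<lambda>u. g (max 0 u)) \<in> borel_measurable borel"
    by (intro borel_measurable_continuous_onI g_max_cont)
  show ?thesis
    unfolding rate_def[abs_def] by measurable
qed

lemma rate_pos: "0 < x \<Longrightarrow> 0 < rate x"
  using g_pos[of x] by (simp add: rate_def)

lemma rate_primitive_deriv:
  assumes "0 < x"
  shows "(rate_primitive has_real_derivative rate x) (at x)"
proof -
  have "isCont rate u" if "0 < u" for u
  proof -
    have "isCont (\<lambda>u. g (max 0 u)) u"
      using g_max_cont[of UNIV] by (simp add: continuous_on_eq_continuous_at)
    then show ?thesis
      unfolding rate_def[abs_def] using g_pos[OF that] that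
      by (intro continuous_intros) auto
  qed
  then obtain P where "\<And>u::real. (0::ereal) < u \<Longrightarrow> u < \<infinity> \<Longrightarrow> (P has_vector_derivative rate u) (at u)"
    using einterval_antiderivative[of 0 \<infinity> rate] by auto
  then have "\<forall>x>0. (P has_real_derivative rate x) (at x)"
    by (simp add: has_real_derivative_iff_has_vector_derivative)
  then have "\<forall>x>0. (rate_primitive has_real_derivative rate x) (at x)"
    unfolding rate_primitive_def by (rule someI[of "\<lambda>P. \<forall>x>0. (P has_real_derivative rate x) (at x)"])
  with assms show ?thesis by simp
qed

lemma rate_primitive_strict_mono: "0 < a \<Longrightarrow> a < b \<Longrightarrow> rate_primitive a < rate_primitive b"
  by (rule DERIV_pos_imp_increasing) (auto intro!: exI[of _ "rate _"] rate_primitive_deriv rate_pos)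

lemma sets_rate_measure [simp]: "sets rate_measure = sets borel"
  by (simp add: rate_measure_def)

lemma emeasure_rate_measure:
  "A \<in> sets borel \<Longrightarrow> emeasure rate_measure A = (\<integral>\<^sup>+u\<in>A. ennreal (rate u) \<partial>lborel)"
  by (simp add: rate_measure_def emeasure_density)

lemma emeasure_rate_measure_nonneg:
  assumes "A \<in> sets borel" "A \<subseteq> {0..}"
  shows "(\<integral>\<^sup>+u\<in>A. ennreal (1 / sqrt (2 * g u)) \<partial>lborel) = emeasure rate_measure A"
  using assms by (auto simp: emeasure_rate_measure rate_def max_def indicator_def intro!: nn_integral_cong)

lemma emeasure_rate_measure_Icc:
  assumes "0 < a" "a \<le> b"
  shows "emeasure rate_measure {a..b} = ennreal (rate_primitive b - rate_primitive a)"
  using assms rate_primitive_deriv rate_pos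
  by (auto simp: emeasure_rate_measure intro!: nn_integral_FTC_Icc less_imp_le[OF rate_pos])

lemma null_rate_measure: "{x} \<in> null_sets rate_measure"
proof (rule null_setsI)
  show "emeasure rate_measure {x} = 0"
    by (subst emeasure_rate_measure) (auto intro!: nn_integral_null_set)
qed simp

lemma G_fun_eq_rate_measure:
  "0 \<le> x \<Longrightarrow> G_fun g x = (if 1 \<le> x then enn2ereal (emeasure rate_measure {1..x})
     else - enn2ereal (emeasure rate_measure {x..1}))"
  by (auto simp: G_fun_def emeasure_rate_measure_nonneg)

lemma G_fun_eq_rate_primitive:
  assumes "0 < x"
  shows "G_fun g x = ereal (rate_primitive x - rate_primitive 1)"
proof -
  have "rate_primitive 1 \<le> rate_primitive x" if "1 \<le> x"
    using rate_primitive_strict_mono[of 1 x] that by (cases "x = 1") auto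
  moreover have "rate_primitive x \<le> rate_primitive 1" if "x < 1"
    using rate_primitive_strict_mono[of x 1] that assms by auto
  ultimately show ?thesis
    using assms by (auto simp: G_fun_eq_rate_measure emeasure_rate_measure_Icc enn2ereal_ennreal)
qed

text \<open>Continuity from below along \<open>{1 / real (Suc n)..1}\<close>, with the point 0 added
  as a null set. In \<open>ereal\<close> this includes the case in which \<open>G\<close> is minus
  infinity at 0.\<close>

lemma G_fun_tendsto_0: "(\<lambda>n. G_fun g (1 / real (Suc n))) \<longlonglongrightarrow> G_fun g 0"
proof -
  let ?A = "\<lambda>n. {1 / real (Suc n)..1}"
  have "incseq ?A"
    by (auto simp: incseq_def frac_le intro: order_trans[rotated])
  then have "(\<lambda>n. emeasure rate_measure (?A n)) \<longlonglongrightarrow> emeasure rate_measure (\<Union>n. ?A n)"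
    by (intro Lim_emeasure_incseq) auto
  also have "(\<Union>n. ?A n) = {0<..1::real}"
  proof (intro equalityI subsetI)
    fix x :: real assume "x \<in> {0<..1}"
    moreover from this obtain n where "inverse (real (Suc n)) < x"
      using reals_Archimedean[of x] by auto
    ultimately show "x \<in> (\<Union>n. ?A n)"
      by (auto simp: divide_inverse intro!: exI[of _ n])
  qed (auto intro: less_le_trans[rotated])
  also have "emeasure rate_measure {0<..1} = emeasure rate_measure ({0<..1} \<union> {0})"
    by (intro emeasure_Un_null_set[symmetric] null_rate_measure) auto
  also have "{0<..1} \<union> {0} = {0..1::real}"
    by auto
  finally have "(\<lambda>n. - enn2ereal (emeasure rate_measure (?A n))) \<longlonglongrightarrow> - enn2ereal (emeasure rate_measure {0..1})"
    by (intro tendsto_uminus_ereal tendsto_enn2erealI)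
  \<comment> \<open>For \<open>n = 0\<close> the argument is 1 and \<open>G_fun\<close> takes its
    other branch; both values are 0 because points are null.\<close>
  moreover have "G_fun g (1 / real (Suc n)) = - enn2ereal (emeasure rate_measure (?A n))" for n
    using null_setsD1[OF null_rate_measure[of 1]] by (cases "n = 0") (auto simp: G_fun_eq_rate_measure zero_ennreal.rep_eq)
  ultimately show ?thesis
    by (simp add: G_fun_eq_rate_measure)
qed

lemma G_fun_mono:
  assumes "0 \<le> x" "x \<le> y"
  shows "G_fun g x \<le> G_fun g y"
proof -
  have *: "G_fun g x \<le> G_fun g y" if "0 < x" "x \<le> y" for x y
    using rate_primitive_strict_mono[of x y] that
    by (cases "x = y") (auto simp: G_fun_eq_rate_primitive)
  show ?thesis
  proof (cases "x = 0 \<and> 0 < y")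
    case True
    then have "\<forall>\<^sub>F n in sequentially. 1 / real (Suc n) < y"
      using order_tendstoD(2)[OF LIMSEQ_inverse_real_of_nat, of y] by (simp add: divide_inverse)
    then have "\<forall>\<^sub>F n in sequentially. G_fun g (1 / real (Suc n)) \<le> G_fun g y"
      by eventually_elim (auto intro: *)
    then have "G_fun g 0 \<le> G_fun g y"
      by (rule tendsto_upperbound[OF G_fun_tendsto_0]) simp
    with True show ?thesis by simp
  next
    case False
    then show ?thesis
      using assms * by (cases "x = 0") auto
  qed
qed

text \<open>The midpoint is positive even when \<open>x = 0\<close>, so the strict part can be read
  off \<open>rate_primitive\<close>.\<close>

lemma G_fun_strict_mono:
  assumes "0 \<le> x" "x < y"
  shows "G_fun g x < G_fun g y"
proof -
  have "G_fun g x \<le> G_fun g ((x + y) / 2)"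
    using assms by (intro G_fun_mono) auto
  also have "\<dots> < G_fun g y"
    using assms rate_primitive_strict_mono[of "(x + y) / 2" y] by (simp add: G_fun_eq_rate_primitive)
  finally show ?thesis .
qed

lemma G_fun_continuous: "continuous_on {0..} (G_fun g)"
  unfolding continuous_on_def
proof
  fix x :: real assume "x \<in> {0..}"
  show "(G_fun g \<longlongrightarrow> G_fun g x) (at x within {0..})"
  proof (cases "x = 0")
    case True
    show ?thesis
      unfolding True
    \<comment> \<open>At 0, lower bounds come from monotonicity alone; upper bounds pass from the
      points \<open>1 / real (Suc n)\<close> to all smaller arguments.\<close>
    proof (rule order_tendstoI)
      fix l assume "l < G_fun g 0"
      then have "l < G_fun g u" if "0 \<le> u" for u
        using G_fun_mono[of 0 u] that by auto
      then show "\<forall>\<^sub>F u in at 0 within {0..}. l < G_fun g u"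
        by (auto simp: eventually_at_filter)
    next
      fix l assume "G_fun g 0 < l"
      then obtain n where n: "G_fun g (1 / real (Suc n)) < l"
        using order_tendstoD(2)[OF G_fun_tendsto_0, of l] eventually_happens'[of sequentially] by auto
      have "G_fun g u < l" if "0 \<le> u" "u < 1 / real (Suc n)" for u
        using G_fun_mono[of u "1 / real (Suc n)"] that n by auto
      moreover have "\<forall>\<^sub>F u in at 0 within {0..}. u < 1 / real (Suc n)"
        by (rule order_tendstoD(2)[of "\<lambda>u. u"]) (auto intro: tendsto_ident_at)
      ultimately show "\<forall>\<^sub>F u in at 0 within {0..}. G_fun g u < l"
        by (auto simp: eventually_at_filter elim!: eventually_mono)
    qed
  next
    case False
    with \<open>x \<in> {0..}\<close> have "0 < x" by simp
    have "(rate_primitive \<longlongrightarrow> rate_primitive x) (at x)"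
      using DERIV_isCont[OF rate_primitive_deriv[OF \<open>0 < x\<close>]] by (simp add: isCont_def)
    then have "((\<lambda>u. ereal (rate_primitive u - rate_primitive 1)) \<longlongrightarrow> G_fun g x) (at x)"
      using \<open>0 < x\<close> by (auto simp: G_fun_eq_rate_primitive intro!: tendsto_intros)
    moreover have "\<forall>\<^sub>F u in at x. ereal (rate_primitive u - rate_primitive 1) = G_fun g u"
      using eventually_at_in_open'[of "{0<..}" x] \<open>0 < x\<close>
      by (auto simp: G_fun_eq_rate_primitive elim!: eventually_mono)
    ultimately have "(G_fun g \<longlongrightarrow> G_fun g x) (at x)"
      by (rule Lim_transform_eventually)
    then show ?thesis
      by (rule tendsto_within_subset) simp
  qed
qed

text \<open>By continuity from below, some compact piece of the tail already has measure greater
  than \<open>c\<close>.\<close>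

lemma G_fun_tail:
  assumes x: "0 \<le> x" and c: "0 \<le> c"
    and tail: "ennreal c < (\<integral>\<^sup>+u\<in>{x..}. ennreal (1 / sqrt (2 * g u)) \<partial>lborel)"
  obtains b where "x \<le> b" "G_fun g x + ereal c \<le> G_fun g b"
proof -
  \<comment> \<open>The left ends stay off \<open>x\<close>, which may be 0, so that
    \<open>rate_primitive\<close> gives the measure of each interval.\<close>
  let ?A = "\<lambda>n. {x + 1 / real (Suc n)..x + real n}"
  have "incseq ?A"
  proof (rule incseq_SucI, rule subsetI)
    fix n u assume "u \<in> ?A n"
    moreover have "1 / real (Suc (Suc n)) \<le> 1 / real (Suc n)"
      by (simp add: frac_le)
    ultimately show "u \<in> ?A (Suc n)"
      by auto
  qed
  have "ennreal c < emeasure rate_measure {x..}"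
    using tail x by (simp add: emeasure_rate_measure_nonneg)
  also have "{x..} = {x<..} \<union> {x}"
    by auto
  also have "emeasure rate_measure ({x<..} \<union> {x}) = emeasure rate_measure {x<..}"
    by (intro emeasure_Un_null_set null_rate_measure) auto
  also have "{x<..} = (\<Union>n. ?A n)"
  proof (intro equalityI subsetI)
    fix u assume "u \<in> {x<..}"
    then obtain n where n: "inverse (real (Suc n)) < u - x"
      using reals_Archimedean[of "u - x"] by auto
    obtain m where m: "u - x \<le> real m"
      using real_arch_simple by blast
    have "inverse (real (Suc (max m n))) \<le> inverse (real (Suc n))"
      by (intro le_imp_inverse_le) auto
    then have "x + 1 / real (Suc (max m n)) \<le> u" "u \<le> x + real (max m n)"
      using n m by (simp_all only: divide_inverse)
    then have "u \<in> ?A (max m n)"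
      by simp
    then show "u \<in> (\<Union>n. ?A n)"
      by blast
  next
    fix u assume "u \<in> (\<Union>n. ?A n)"
    then obtain n where "u \<in> ?A n" by blast
    moreover have "0 < 1 / real (Suc n)" by simp
    ultimately show "u \<in> {x<..}" by (simp only: atLeastAtMost_iff greaterThan_iff) linarith
  qed
  finally obtain n where n: "ennreal c < emeasure rate_measure (?A n)"
    using order_tendstoD(1)[OF Lim_emeasure_incseq[OF _ \<open>incseq ?A\<close>, of rate_measure]]
      eventually_happens'[of sequentially] by fastforce
  define a b where "a = x + 1 / real (Suc n)" and "b = x + real n"
  have "x < a" by (simp add: a_def)
  have "a \<le> b"
  proof (rule ccontr)
    assume "\<not> a \<le> b"
    then have "?A n = {}"
      by (simp add: a_def b_def)
    with n show False by simp
  qed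
  have "ennreal c < ennreal (rate_primitive b - rate_primitive a)"
    using n emeasure_rate_measure_Icc[of a b] \<open>x < a\<close> \<open>a \<le> b\<close> x
    unfolding a_def[symmetric] b_def[symmetric] by simp
  then have "c < rate_primitive b - rate_primitive a"
    using c ennreal_leI[of "rate_primitive b - rate_primitive a" c] by (auto simp: not_less[symmetric])
  then have "G_fun g a + ereal c \<le> G_fun g b"
    using \<open>x < a\<close> \<open>a \<le> b\<close> x by (simp add: G_fun_eq_rate_primitive)
  moreover have "G_fun g x + ereal c \<le> G_fun g a + ereal c"
    using \<open>x < a\<close> x by (intro add_right_mono G_fun_mono) auto
  ultimately show ?thesis
    using \<open>x < a\<close> \<open>a \<le> b\<close> by (intro that[of b]) auto
qed

text \<open>The intermediate value theorem for the \<open>ereal\<close>-valued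
  \<open>G_fun g\<close>, between \<open>x\<close> and the point from \<open>G_fun_tail\<close>,
  shows that the value is attained; hence \<open>inv_into\<close> is a true right inverse
  there.\<close>

lemma
  assumes x: "0 \<le> x" and c: "0 \<le> c"
    and tail: "ennreal c < (\<integral>\<^sup>+u\<in>{x..}. ennreal (1 / sqrt (2 * g u)) \<partial>lborel)"
  shows G_inv_nonneg: "0 \<le> G_inv g (G_fun g x + ereal c)"
    and G_fun_G_inv: "G_fun g (G_inv g (G_fun g x + ereal c)) = G_fun g x + ereal c"
proof -
  obtain b where b: "x \<le> b" "G_fun g x + ereal c \<le> G_fun g b"
    using G_fun_tail[OF assms] .
  have "G_fun g x + 0 \<le> G_fun g x + ereal c"
    using c by (intro add_left_mono) auto
  then obtain z where "x \<le> z" "z \<le> b" "G_fun g z = G_fun g x + ereal c"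
    using IVT'[of "G_fun g" x "G_fun g x + ereal c" b] b x continuous_on_subset[OF G_fun_continuous]
    by fastforce
  then have "G_fun g x + ereal c \<in> G_fun g ` {0..}"
    using x by (metis atLeast_iff image_eqI order_trans)
  then show "0 \<le> G_inv g (G_fun g x + ereal c)"
    and "G_fun g (G_inv g (G_fun g x + ereal c)) = G_fun g x + ereal c"
    unfolding G_inv_def using inv_into_into[of _ "G_fun g" "{0..}"] f_inv_into_f[of _ "G_fun g" "{0..}"]
    by auto
qed

text \<open>The constant \<open>A\<close> contributes at most \<open>\<Gamma> * A\<close> and is
  absorbed into the starting value. What remains is majorised by a function \<open>y\<close> with
  \<open>rate (y t) * y' t \<le> c t\<close>, so \<open>G\<close> along \<open>y\<close> grows no
  faster than \<open>C\<close>.\<close>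

lemma bihari:
  assumes ab: "a \<le> b"
    and z: "\<And>t. t \<in> {a..b} \<Longrightarrow> (z has_real_derivative z' t) (at t)"
    and C: "\<And>t. t \<in> {a..b} \<Longrightarrow> (C has_real_derivative c t) (at t)"
    and c_cont: "continuous_on {a..b} c" and c_nonneg: "\<And>t. t \<in> {a..b} \<Longrightarrow> 0 \<le> c t"
    and z': "\<And>t. t \<in> {a..b} \<Longrightarrow> \<bar>z' t\<bar> \<le> c t * (sqrt (2 * g \<bar>z t\<bar>) + A)"
    and za: "\<bar>z a\<bar> \<le> n" and A: "0 \<le> A" and \<Gamma>: "C b - C a \<le> \<Gamma>"
  shows "G_fun g \<bar>z b\<bar> \<le> G_fun g (n + \<Gamma> * A) + ereal \<Gamma>"
proof -
  define q where "q t = c t * sqrt (2 * g \<bar>z t\<bar>)" for t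
  \<comment> \<open>Clamping to \<open>{a..b}\<close> makes the integrand continuous on the line, so
    \<open>Q\<close> has two-sided derivatives at the ends too.\<close>
  define r where "r t = max a (min t b)" for t
  define Q where "Q t = primitive (q \<circ> r) t - primitive (q \<circ> r) a" for t
  define x where "x = n + \<Gamma> * A"
  have z_cont: "continuous_on {a..b} z"
    by (meson z DERIV_isCont continuous_at_imp_continuous_on)
  have q_cont: "continuous_on {a..b} q"
    unfolding q_def
    by (intro continuous_intros c_cont continuous_on_compose2[OF g_cont] z_cont) auto
  have "continuous_on UNIV (q \<circ> r)"
    by (rule continuous_on_compose[OF _ continuous_on_subset[OF q_cont]])
       (use ab in \<open>auto simp: r_def intro!: continuous_intros\<close>)
  from primitive_deriv[OF this] have Q: "(Q has_real_derivative q t) (at t)" if "t \<in> {a..b}" for t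
    using that unfolding Q_def[abs_def]
    by (auto intro!: derivative_eq_intros simp: r_def min_def max_def)
  have q_nonneg: "0 \<le> q t" if "t \<in> {a..b}" for t
    using c_nonneg[OF that] g_nonneg[of "\<bar>z t\<bar>"] by (simp add: q_def)
  have mono: "u s \<le> u t"
    if "a \<le> s" "s \<le> t" "t \<le> b" "\<And>t. t \<in> {a..b} \<Longrightarrow> (u has_real_derivative u' t) (at t) \<and> 0 \<le> u' t"
    for u u' :: "real \<Rightarrow> real" and s t
  proof (rule DERIV_nonneg_imp_nondecreasing[OF that(2)])
    fix x assume "s \<le> x" "x \<le> t"
    then show "\<exists>y. (u has_real_derivative y) (at x) \<and> 0 \<le> y"
      using that(1,3) that(4)[of x] by auto
  qed
  have C_mono: "C s \<le> C t" if "a \<le> s" "s \<le> t" "t \<le> b" for s t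
    using mono[of s t C c] that C c_nonneg by blast
  have Q_nonneg: "0 \<le> Q t" if "t \<in> {a..b}" for t
    using mono[of a t Q q] that Q q_nonneg by (auto simp: Q_def)
  \<comment> \<open>Both \<open>A * C + Q - z\<close> and \<open>A * C + Q + z\<close> are
    nondecreasing, by the bound on \<open>z'\<close>.\<close>
  have z_le: "\<bar>z t\<bar> \<le> x + Q t" if t: "t \<in> {a..b}" for t
  proof -
    have "z' s \<le> A * c s + q s" "- (A * c s + q s) \<le> z' s" if "s \<in> {a..b}" for s
      using z'[OF that] by (auto simp: q_def abs_le_iff algebra_simps)
    then have "A * C a + Q a - z a \<le> A * C t + Q t - z t" "A * C a + Q a + z a \<le> A * C t + Q t + z t"
      using t
      by (intro mono[where u' = "\<lambda>s. A * c s + q s - z' s" and u = "\<lambda>t. A * C t + Q t - z t"]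
                mono[where u' = "\<lambda>s. A * c s + q s + z' s" and u = "\<lambda>t. A * C t + Q t + z t"];
          fastforce intro!: derivative_eq_intros C Q z)+
    then have "\<bar>z t\<bar> \<le> \<bar>z a\<bar> + A * (C t - C a) + Q t"
      by (auto simp: Q_def algebra_simps)
    moreover have "A * (C t - C a) \<le> A * \<Gamma>"
      using C_mono[of t b] t \<Gamma> A by (intro mult_left_mono) auto
    ultimately show ?thesis
      using za by (simp add: x_def algebra_simps)
  qed
  have x0: "0 \<le> x"
    using za A \<Gamma> C_mono[of a b] ab by (auto simp: x_def)
  \<comment> \<open>The shift by \<open>\<epsilon>\<close> keeps the majorant positive, where
    \<open>rate_primitive\<close> is differentiable; \<open>x\<close> itself may be 0.\<close>
  have shifted: "G_fun g \<bar>z b\<bar> \<le> G_fun g (x + \<epsilon>) + ereal \<Gamma>" if \<epsilon>: "0 < \<epsilon>" for \<epsilon>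
  proof -
    define y where "y t = x + \<epsilon> + Q t" for t
    have y_pos: "0 < y t" if "t \<in> {a..b}" for t
      using x0 \<epsilon> Q_nonneg[OF that] by (simp add: y_def)
    have le: "rate (y t) * q t \<le> c t" if t: "t \<in> {a..b}" for t
    proof -
      have "g \<bar>z t\<bar> \<le> g (y t)"
        using z_le[OF t] \<epsilon> y_pos[OF t] by (intro mono_onD[OF g_mono]) (auto simp: y_def)
      then have "sqrt (2 * g \<bar>z t\<bar>) / sqrt (2 * g (y t)) \<le> 1"
        using g_pos[OF y_pos[OF t]] by simp
      then have "c t * (sqrt (2 * g \<bar>z t\<bar>) / sqrt (2 * g (y t))) \<le> c t * 1"
        by (intro mult_left_mono c_nonneg t)
      then show ?thesis
        using y_pos[OF t] by (simp add: rate_def q_def mult.commute)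
    qed
    have "C a - rate_primitive (y a) \<le> C b - rate_primitive (y b)"
    proof (rule mono[where u = "\<lambda>t. C t - rate_primitive (y t)" and u' = "\<lambda>t. c t - rate (y t) * q t"], goal_cases)
      case (4 t)
      have y: "(y has_real_derivative q t) (at t)"
        unfolding y_def using Q[OF 4] by (auto intro!: derivative_eq_intros)
      have "((\<lambda>t. rate_primitive (y t)) has_real_derivative rate (y t) * q t) (at t)"
        by (rule DERIV_chain2[where f = rate_primitive and g = y and x = t, OF rate_primitive_deriv[OF y_pos[OF 4]] y])
      with le[OF 4] show ?case
        using DERIV_diff[OF C[OF 4]] by simp
    qed (use ab in auto)
    then have "rate_primitive (y b) \<le> rate_primitive (x + \<epsilon>) + \<Gamma>"
      using \<Gamma> by (simp add: y_def Q_def)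
    then have "G_fun g (y b) \<le> G_fun g (x + \<epsilon>) + ereal \<Gamma>"
      using x0 \<epsilon> y_pos[of b] ab by (simp add: G_fun_eq_rate_primitive)
    moreover have "G_fun g \<bar>z b\<bar> \<le> G_fun g (y b)"
      using z_le[of b] \<epsilon> ab by (intro G_fun_mono) (auto simp: y_def)
    ultimately show ?thesis
      by (rule order_trans[rotated])
  qed
  \<comment> \<open>The shift is removed by continuity of \<open>G_fun g\<close> on the closed
    half-line, with minus infinity as a possible limit.\<close>
  have "(\<lambda>k. x + inverse (real (Suc k))) \<longlonglongrightarrow> x"
    using tendsto_add[OF tendsto_const LIMSEQ_inverse_real_of_nat, of x] by simp
  then have "filterlim (\<lambda>k. x + inverse (real (Suc k))) (at x within {0..}) sequentially"
    using x0 by (simp add: filterlim_at)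
  then have "(\<lambda>k. G_fun g (x + inverse (real (Suc k)))) \<longlonglongrightarrow> G_fun g x"
    using G_fun_continuous x0 by (auto simp: continuous_on_def intro: filterlim_compose)
  then have "(\<lambda>k. G_fun g (x + inverse (real (Suc k))) + ereal \<Gamma>) \<longlonglongrightarrow> G_fun g x + ereal \<Gamma>"
    by (intro tendsto_add_ereal_general) auto
  then have "G_fun g \<bar>z b\<bar> \<le> G_fun g x + ereal \<Gamma>"
    by (rule tendsto_lowerbound) (auto intro!: always_eventually shifted)
  then show ?thesis
    by (simp add: x_def)
qed

end

section \<open>Truncation and the a priori bound\<close>

text \<open>A continuity argument in which the hypothesis up to the larger level \<open>c'\<close> improves itself to
  the smaller level \<open>c\<close>.\<close>

lemma continuity_bootstrap:
  fixes E :: "real \<Rightarrow> real"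
  assumes ab: "a \<le> b" and cont: "continuous_on {a..b} E" and "c < c'" and Ea: "E a \<le> c"
    and step: "\<And>s. s \<in> {a..b} \<Longrightarrow> (\<And>u. u \<in> {a..s} \<Longrightarrow> E u \<le> c') \<Longrightarrow> E s \<le> c"
  shows "E b \<le> c"
proof (rule ccontr)
  assume "\<not> E b \<le> c"
  \<comment> \<open>A level above \<open>c\<close> that does not exceed \<open>c'\<close> and that
    \<open>E\<close> must reach if the claim fails.\<close>
  define e where "e = min (E b) c'"
  have e: "c < e" "e \<le> c'" "e \<le> E b"
    using \<open>\<not> E b \<le> c\<close> \<open>c < c'\<close> by (auto simp: e_def)
  define S where "S = {t \<in> {a..b}. E t = e}"
  obtain t0 where "t0 \<in> S"
    using IVT'[of E a e b, OF _ _ ab cont] e Ea unfolding S_def by auto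
  moreover have "compact S"
  proof -
    have "closed S"
      unfolding S_def by (rule continuous_closed_preimage_constant[OF cont]) simp
    moreover have "bounded S"
      by (rule bounded_subset[of "{a..b}"]) (auto simp: S_def)
    ultimately show ?thesis
      by (simp add: compact_eq_bounded_closed)
  qed
  \<comment> \<open>At the first time the level \<open>e\<close> is reached, \<open>E\<close> has
    not yet exceeded \<open>c'\<close>, so \<open>step\<close> applies and contradicts
    \<open>E s = e\<close>.\<close>
  ultimately obtain s where s: "s \<in> S" "\<And>t. t \<in> S \<Longrightarrow> s \<le> t"
    using compact_attains_inf[of S] by blast
  have "E u \<le> c'" if u: "u \<in> {a..s}" for u
  proof (rule ccontr)
    assume "\<not> E u \<le> c'"
    with e have "e < E u" by simp
    obtain v where "a \<le> v" "v \<le> u" "E v = e"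
      using IVT'[of E a e u] e Ea u s(1) \<open>e < E u\<close> continuous_on_subset[OF cont, of "{a..u}"]
      unfolding S_def by auto
    then have "s \<le> v"
      using u s by (intro s(2)) (auto simp: S_def)
    with \<open>v \<le> u\<close> u have "u = v" by simp
    with \<open>E v = e\<close> \<open>e < E u\<close> show False by simp
  qed
  then have "E s \<le> c"
    using s(1) by (intro step) (auto simp: S_def)
  with s(1) e show False
    by (simp add: S_def)
qed

lemma Gam_eq_primitive: "Gam \<gamma> = primitive (\<lambda>s. \<bar>\<gamma> s\<bar>) 1"
  by (simp add: Gam_def primitive_def one_ereal_def[symmetric])

text \<open>A bounded nonlinearity whose primitive takes only values of the primitive of \<open>f\<close>: compose the
  latter with a function that is the identity on \<open>{-R..R}\<close> and locally constant far away.\<close>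

lemma bounded_truncation:
  assumes f: "continuous_on UNIV f" and f_odd: "odd_fun f"
  obtains f' :: "real \<Rightarrow> real" and b :: real and \<eta> :: "real \<Rightarrow> real" where
    "continuous_on UNIV f'" "\<And>x. \<bar>f' x\<bar> \<le> b" "\<And>x. f' (- x) = - f' x"
    "\<And>x. ((\<lambda>x. primitive f (\<eta> x)) has_real_derivative f' x) (at x)"
    "\<And>x. primitive f (\<eta> (- x)) = primitive f (\<eta> x)"
    "\<And>x. \<bar>x\<bar> \<le> R \<Longrightarrow> \<eta> x = x" "\<And>x. \<bar>x\<bar> \<le> R \<Longrightarrow> f' x = f x"
proof -
  \<comment> \<open>A continuous even cutoff, 1 up to distance \<open>R\<close> and 0 from distance
    \<open>R + 1\<close> on. It is the derivative of \<open>\<eta>\<close>, so the chain rule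
    produces \<open>f'\<close>, which vanishes outside a compact set.\<close>
  define e where "e x = max 0 (min 1 (R + 1 - \<bar>x\<bar>))" for x :: real
  define \<eta> where "\<eta> = primitive e"
  define f' where "f' x = f (\<eta> x) * e x" for x
  have e_cont: "continuous_on A e" for A
    unfolding e_def by (intro continuous_intros)
  have \<eta>_odd: "\<eta> (- x) = - \<eta> x" for x
    unfolding \<eta>_def by (rule primitive_odd[OF e_cont]) (simp add: e_def)
  have prim_one: "primitive (\<lambda>_. 1) x = x" for x :: real
    by (rule DERIV_eq_imp_eq[where a = 0 and w = "\<lambda>_. 1", OF primitive_deriv]) auto
  have \<eta>_pos: "\<eta> x = x" if "0 \<le> x" "x \<le> R" for x
  proof -
    have "primitive e x = primitive (\<lambda>_. 1) x"
      using that by (intro primitive_cong e_cont) (auto simp: e_def)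
    then show ?thesis by (simp add: \<eta>_def prim_one)
  qed
  have \<eta>_id: "\<eta> x = x" if "\<bar>x\<bar> \<le> R" for x
    using \<eta>_pos[of x] \<eta>_pos[of "- x"] \<eta>_odd[of x] that by (cases "0 \<le> x") auto
  have f'_cont: "continuous_on A f'" for A
    unfolding f'_def \<eta>_def
    by (intro continuous_intros e_cont continuous_on_compose2[OF f primitive_continuous[OF e_cont]]) auto
  have "compact (f' ` {- (R + 1)..R + 1})"
    by (intro compact_continuous_image f'_cont) auto
  then obtain b where b: "\<And>x. x \<in> {- (R + 1)..R + 1} \<Longrightarrow> \<bar>f' x\<bar> \<le> b"
    using compact_imp_bounded[THEN bounded_iff[THEN iffD1]] by force
  have "\<bar>f' x\<bar> \<le> max 0 b" for x
  proof (cases "x \<in> {- (R + 1)..R + 1}")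
    case False
    then have "e x = 0" by (auto simp: e_def)
    then show ?thesis by (simp add: f'_def)
  qed (use b in fastforce)
  moreover have "((\<lambda>x. primitive f (\<eta> x)) has_real_derivative f' x) (at x)" for x
    unfolding f'_def
    using DERIV_chain2[where f = "primitive f" and g = \<eta> and x = x, OF primitive_deriv[OF f]]
      primitive_deriv[OF e_cont, of x] by (simp add: \<eta>_def)
  moreover have "primitive f (\<eta> (- x)) = primitive f (\<eta> x)" for x
    unfolding \<eta>_odd by (rule primitive_even[OF f]) (use f_odd in \<open>simp add: odd_fun_def\<close>)
  moreover have "f' (- x) = - f' x" for x
    using f_odd by (simp add: f'_def \<eta>_odd odd_fun_def) (simp add: e_def)
  moreover have "f' x = f x" if "\<bar>x\<bar> \<le> R" for x
    using that by (simp add: f'_def \<eta>_id) (simp add: e_def)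
  ultimately show ?thesis
    using that[of f' "max 0 b" \<eta>] f'_cont \<eta>_id by blast
qed

text \<open>Differentiating \<open>primitive h (Hinv h I e) = e\<close> gives the reciprocal
  relation for the derivative; its product form also shows that \<open>h\<close> does not vanish
  there.\<close>

lemma
  assumes h: "continuous_on UNIV h" and J: "open J"
    and diffeo: "C1_diffeomorphism (primitive h) I J"
  shows primitive_Hinv: "e \<in> J \<Longrightarrow> primitive h (Hinv h I e) = e"
    and Hinv_continuous: "continuous_on J (Hinv h I)"
    and Hinv_deriv: "e \<in> J \<Longrightarrow> \<exists>k. (Hinv h I has_real_derivative k) (at e) \<and> k * h (Hinv h I e) = 1"
proof -
  have HK: "primitive h (Hinv h I e) = e" if "e \<in> J" for e
    using diffeo that by (simp add: C1_diffeomorphism_def bij_betw_def Hinv_def f_inv_into_f)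
  obtain k where k: "\<And>e. e \<in> J \<Longrightarrow> (Hinv h I has_real_derivative k e) (at e)"
    using diffeo unfolding C1_diffeomorphism_def C1_differentiable_on_def Hinv_def
      has_real_derivative_iff_has_vector_derivative by blast
  show "continuous_on J (Hinv h I)"
    by (meson k DERIV_isCont continuous_at_imp_continuous_on)
  show "e \<in> J \<Longrightarrow> primitive h (Hinv h I e) = e"
    by (rule HK)
  show "\<exists>k. (Hinv h I has_real_derivative k) (at e) \<and> k * h (Hinv h I e) = 1" if e: "e \<in> J"
  proof -
    have "((\<lambda>e. primitive h (Hinv h I e)) has_real_derivative h (Hinv h I e) * k e) (at e)"
      by (rule DERIV_chain2[where f = "primitive h" and g = "Hinv h I" and x = e, OF primitive_deriv[OF h] k[OF e]])
    moreover have "((\<lambda>e. primitive h (Hinv h I e)) has_real_derivative 1) (at e)"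
      by (rule has_field_derivative_transform_within_open[OF DERIV_ident J e]) (simp add: HK)
    ultimately have "k e * h (Hinv h I e) = 1"
      using DERIV_unique by (fastforce simp: mult.commute)
    then show ?thesis
      using k[OF e] by blast
  qed
qed

theorem theorem6:
  fixes h f \<gamma> g :: "real \<Rightarrow> real" and I J :: "real set" and d M :: real
  assumes h_cont: "continuous_on UNIV h"
    and \<gamma>_periodic: "one_periodic \<gamma>"
    and I_interval: "open I" "is_interval I"
    and J_interval: "open J" "is_interval J"
    and H_diffeo: "C1_diffeomorphism (primitive h) I J"
    and g_cont: "continuous_on {0..} g"
    and g_mono: "mono_on {0..} g"
    and g_nonneg: "\<And>r. r \<ge> 0 \<Longrightarrow> g r \<ge> 0"
    and g_pos: "\<And>r. r > 0 \<Longrightarrow> g r > 0"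
    and i: "\<And>\<psi>. \<bar>primitive f \<psi>\<bar> \<le> M"
    and ii: "\<And>z. \<bar>primitive h z\<bar> \<le> g \<bar>z\<bar>"
    and iv: "ennreal (Gam \<gamma>) <
      (\<integral>\<^sup>+u\<in>{N_const h f I d + Gam \<gamma> * sqrt (2 * (M + \<bar>d\<bar>))..}.
          ennreal (1 / sqrt (2 * g u)) \<partial>lborel)"
    and A1: "odd_fun f" "continuous_on UNIV f"
    and A2: "odd_fun \<gamma>" "continuous_on UNIV \<gamma>"
    and A3: "{- d - M .. - d + M + (M1_const h f \<gamma> g I d M)\<^sup>2 / 2} \<subseteq> J"
  shows "\<exists>\<psi>. is_solution h f \<gamma> I J d \<psi> \<and> one_periodic \<psi> \<and> odd_fun \<psi>"
proof -
  interpret growth_function g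
    by unfold_locales (fact g_cont g_mono g_nonneg g_pos)+

  \<comment> \<open>Constants and their bounds\<close>
  define F where "F = primitive f"
  define K where "K = Hinv h I"
  define \<Gamma> where "\<Gamma> = Gam \<gamma>"
  define A where "A = sqrt (2 * (M + \<bar>d\<bar>))"
  define N where "N = N_const h f I d"
  \<comment> \<open>\<open>Z\<close> is the bound that Bihari's inequality yields for
    \<open>\<bar>z\<bar>\<close>; \<open>C\<close> below is the resulting bound for the
    energy.\<close>
  define Z where "Z = G_inv g (G_fun g (N + \<Gamma> * A) + ereal \<Gamma>)"
  define M1 where "M1 = M1_const h f \<gamma> g I d M"
  define C where "C = - d + M + M1\<^sup>2 / 2"
  have M0: "0 \<le> M"
    using i[of 0] by simp
  have A0: "0 \<le> A"
    using M0 by (simp add: A_def)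
  have C_ge: "M - d \<le> C"
    by (simp add: C_def)
  have A3': "{- d - M..C} \<subseteq> J"
    using A3 by (simp add: C_def M1_def)
  have F_bound: "\<bar>F x\<bar> \<le> M" for x
    using i by (simp add: F_def)
  have HK: "primitive h (K e) = e" if "e \<in> J" for e
    using primitive_Hinv[OF h_cont J_interval(1) H_diffeo that] by (simp add: K_def)
  have K_cont: "continuous_on J K"
    using Hinv_continuous[OF h_cont J_interval(1) H_diffeo] by (simp add: K_def)
  have abs\<gamma>_cont: "continuous_on UNIV (\<lambda>s. \<bar>\<gamma> s\<bar>)"
    by (intro continuous_intros A2)
  have \<Gamma>_eq: "\<Gamma> = primitive (\<lambda>s. \<bar>\<gamma> s\<bar>) 1"
    by (simp add: \<Gamma>_def Gam_eq_primitive)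
  have \<Gamma>0: "0 \<le> \<Gamma>"
    using primitive_has_integral[OF abs\<gamma>_cont, of 0 1] by (auto simp: \<Gamma>_eq dest: has_integral_nonneg)
  \<comment> \<open>The arguments of the inverse in the supremum lie in a compact subinterval of
    \<open>J\<close>, so the set is bounded and its member with \<open>l = 1\<close> is at most
    \<open>N\<close>.\<close>
  have N: "\<bar>K (- F x - d)\<bar> \<le> N" for x
  proof -
    have "compact (K ` {- d - M..C})"
      by (intro compact_continuous_image continuous_on_subset[OF K_cont A3']) auto
    then obtain b where b: "\<And>e. e \<in> {- d - M..C} \<Longrightarrow> \<bar>K e\<bar> \<le> b"
      using compact_imp_bounded[THEN bounded_iff[THEN iffD1]] by force
    have "\<bar>K (- l * F y - d)\<bar> \<le> b" if "0 \<le> l" "l \<le> 1" for l y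
    proof (rule b)
      have "\<bar>l * F y\<bar> \<le> 1 * M"
        unfolding abs_mult using that F_bound[of y] by (intro mult_mono) auto
      then show "- l * F y - d \<in> {- d - M..C}"
        using C_ge by (auto simp: abs_le_iff)
    qed
    then have "bdd_above {\<bar>K (- l * F y - d)\<bar> | y l. 0 \<le> l \<and> l \<le> 1}"
      by (intro bdd_aboveI[of _ b]) auto
    moreover have "\<bar>K (- F x - d)\<bar> \<in> {\<bar>K (- l * F y - d)\<bar> | y l. 0 \<le> l \<and> l \<le> 1}"
      by (rule CollectI, intro exI[of _ x] exI[of _ "1::real"]) simp
    ultimately show ?thesis
      unfolding N_def N_const_def K_def F_def by (rule cSup_upper[rotated])
  qed
  have N0: "0 \<le> N"
    using N[of 0] by linarith
  have Z0: "0 \<le> Z" and GZ: "G_fun g Z = G_fun g (N + \<Gamma> * A) + ereal \<Gamma>"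
    using G_inv_nonneg[of "N + \<Gamma> * A" \<Gamma>] G_fun_G_inv[of "N + \<Gamma> * A" \<Gamma>] N0 \<Gamma>0 A0 iv
    unfolding Z_def N_def \<Gamma>_def A_def by auto
  have M1_sq: "M1\<^sup>2 / 2 = \<bar>d\<bar> + M + g Z"
    using M0 g_nonneg[OF Z0]
    by (simp add: M1_def M1_const_def Z_def N_def \<Gamma>_def A_def add.commute)

  \<comment> \<open>The truncated equation\<close>
  have "C \<in> J"
    using A3' C_ge M0 by auto
  \<comment> \<open>Openness of \<open>J\<close> leaves room above \<open>C\<close>: the continuity
    argument improves the level \<open>C + \<epsilon>\<close> to \<open>C\<close>.\<close>
  then obtain \<epsilon> where \<epsilon>: "0 < \<epsilon>" "cball C \<epsilon> \<subseteq> J"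
    using J_interval(1) open_contains_cball by blast
  have J_large: "{- d - M..C + \<epsilon>} \<subseteq> J"
  proof
    fix e assume "e \<in> {- d - M..C + \<epsilon>}"
    then show "e \<in> J"
      using A3' \<epsilon> by (cases "e \<le> C") (auto simp: dist_real_def subset_iff)
  qed
  \<comment> \<open>The lower cut is never active, since the energy is at least
    \<open>- d - M\<close> by the bound on \<open>F\<close>; the upper cut is excluded later by the
    a priori bound.\<close>
  define cl where "cl e = max (- d - M) (min e (C + \<epsilon>))" for e
  have cl_in: "cl e \<in> {- d - M..C + \<epsilon>}" for e
    using C_ge \<epsilon>(1) M0 by (auto simp: cl_def)
  have cl_id: "cl e = e" if "e \<in> {- d - M..C + \<epsilon>}" for e
    using that by (auto simp: cl_def)
  define k where "k e = h (K (cl e))" for e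
  have hK_cont: "continuous_on {- d - M..C + \<epsilon>} (\<lambda>e. h (K e))"
    by (rule continuous_on_compose2[OF h_cont continuous_on_subset[OF K_cont J_large]]) auto
  have k_cont: "continuous_on UNIV k"
    unfolding k_def by (rule continuous_on_compose2[OF hK_cont]) (use cl_in in \<open>auto simp: cl_def intro!: continuous_intros\<close>)
  obtain bk where bk: "\<And>e. \<bar>k e\<bar> \<le> bk"
  proof -
    have "compact ((\<lambda>e. h (K e)) ` {- d - M..C + \<epsilon>})"
      by (intro compact_continuous_image hK_cont) auto
    then obtain b where b: "\<And>e. e \<in> {- d - M..C + \<epsilon>} \<Longrightarrow> \<bar>h (K e)\<bar> \<le> b"
      using compact_imp_bounded[THEN bounded_iff[THEN iffD1]] by force
    then show ?thesis
      using cl_in by (intro that[of b]) (auto simp: k_def)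
  qed
  \<comment> \<open>From \<open>p\<^sup>2 / 2 = E + F + d \<le> C + M + d\<close>, this bounds the
    slope. It also bounds \<open>\<psi>\<close>, which vanishes at 0 and has period 1.\<close>
  define R where "R = sqrt (2 * (C + M + d))"
  obtain f' bf \<eta> where f'_cont: "continuous_on UNIV f'" and bf: "\<And>x. \<bar>f' x\<bar> \<le> bf"
    and f'_odd: "\<And>x. f' (- x) = - f' x"
    and F'_deriv: "\<And>x. ((\<lambda>x. F (\<eta> x)) has_real_derivative f' x) (at x)"
    and F'_even: "\<And>x. F (\<eta> (- x)) = F (\<eta> x)"
    and \<eta>_id: "\<And>x. \<bar>x\<bar> \<le> R \<Longrightarrow> \<eta> x = x" and f'_eq: "\<And>x. \<bar>x\<bar> \<le> R \<Longrightarrow> f' x = f x"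
  proof (rule bounded_truncation[OF A1(2) A1(1), of R])
    fix f' b \<eta>
    assume *: "continuous_on UNIV f'" "\<And>x. \<bar>f' x\<bar> \<le> b" "\<And>x. f' (- x) = - f' x"
      "\<And>x. ((\<lambda>x. primitive f (\<eta> x)) has_real_derivative f' x) (at x)"
      "\<And>x. primitive f (\<eta> (- x)) = primitive f (\<eta> x)"
      "\<And>x. \<bar>x\<bar> \<le> R \<Longrightarrow> \<eta> x = x" "\<And>x. \<bar>x\<bar> \<le> R \<Longrightarrow> f' x = f x"
    show ?thesis
      unfolding F_def by (rule that[unfolded F_def, of f' b \<eta>]) (fact *)+
  qed
  obtain b\<gamma> where b\<gamma>: "\<And>t. \<bar>\<gamma> t\<bar> \<le> b\<gamma>"
    using one_periodic_bounded[OF \<gamma>_periodic A2(2)] by blast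
  \<comment> \<open>Truncating the primitive with the same \<open>\<eta>\<close> keeps
    \<open>f'\<close> its derivative, so the terms in \<open>f'\<close> cancel in the derivative of
    the energy.\<close>
  define F' where "F' x = F (\<eta> x)" for x
  define \<Phi> where "\<Phi> = (\<lambda>(t, x, p). f' x + \<gamma> t * k (p\<^sup>2 / 2 - F' x - d))"
  have F'_cont: "continuous_on UNIV F'"
    unfolding F'_def by (intro continuous_at_imp_continuous_on ballI DERIV_isCont[OF F'_deriv])
  have \<Phi>_cont: "continuous_on UNIV \<Phi>"
    unfolding \<Phi>_def case_prod_beta
    by (intro continuous_intros continuous_on_compose2[OF f'_cont] continuous_on_compose2[OF A2(2)]
        continuous_on_compose2[OF k_cont] continuous_on_compose2[OF F'_cont]) auto
  have "\<bar>\<Phi> y\<bar> \<le> bf + b\<gamma> * bk" for y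
  proof -
    obtain t x p where y: "y = (t, x, p)" by (cases y)
    have "\<bar>\<gamma> t * k (p\<^sup>2 / 2 - F' x - d)\<bar> \<le> b\<gamma> * bk"
      unfolding abs_mult using b\<gamma>[of t] bk by (intro mult_mono) auto
    then show ?thesis
      using bf[of x] by (simp add: y \<Phi>_def)
  qed
  moreover have "\<Phi> (- t, - x, p) = - \<Phi> (t, x, p)" for t x p
    using A2(1) by (simp add: \<Phi>_def f'_odd F'_def F'_even odd_fun_def)
  moreover have "\<Phi> (t + 1, x, p) = \<Phi> (t, x, p)" for t x p
    using \<gamma>_periodic by (simp add: \<Phi>_def one_periodic_def)
  ultimately obtain \<psi> p where \<psi>: "\<And>t. (\<psi> has_real_derivative p t) (at t)"
    and p: "\<And>t. (p has_real_derivative \<Phi> (t, \<psi> t, p t)) (at t)"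
    and \<psi>_odd: "odd_fun \<psi>" and \<psi>_per: "one_periodic \<psi>"
    using odd_periodic_solution[OF \<Phi>_cont] by blast

  \<comment> \<open>A priori bound on the energy\<close>
  define E where "E t = (p t)\<^sup>2 / 2 - F' (\<psi> t) - d" for t
  have E_deriv: "(E has_real_derivative p t * (\<gamma> t * k (E t))) (at t)" for t
  proof -
    have "((\<lambda>t. F' (\<psi> t)) has_real_derivative f' (\<psi> t) * p t) (at t)"
      unfolding F'_def
      by (rule DERIV_chain2[where f = "\<lambda>x. F (\<eta> x)" and g = \<psi> and x = t, OF F'_deriv \<psi>])
    then have "(E has_real_derivative p t * \<Phi> (t, \<psi> t, p t) - f' (\<psi> t) * p t) (at t)"
      unfolding E_def by (auto intro!: derivative_eq_intros p)
    then show ?thesis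
      by (simp add: \<Phi>_def E_def algebra_simps)
  qed
  have E_ge: "- d - M \<le> E t" for t
    using F_bound[of "\<eta> (\<psi> t)"] zero_le_power2[of "p t"] unfolding E_def F'_def by linarith
  have E_le: "E t \<le> C" for t
  proof -
    \<comment> \<open>The mean value theorem over the period ending at \<open>t\<close> gives a zero
      of the slope. There \<open>N\<close> bounds the inverse, and less than one period separates it
      from \<open>t\<close>.\<close>
    obtain \<tau> where \<tau>: "t - 1 < \<tau>" "\<tau> < t" "p \<tau> = 0"
    proof -
      have "\<psi> (t - 1) = \<psi> t"
        using \<psi>_per unfolding one_periodic_def by (metis diff_add_cancel)
      moreover obtain \<tau> where "t - 1 < \<tau>" "\<tau> < t" "\<psi> t - \<psi> (t - 1) = (t - (t - 1)) * p \<tau>"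
        using MVT2[of "t - 1" t \<psi> p] \<psi> by auto
      ultimately show ?thesis
        using that by auto
    qed
    have E\<tau>: "E \<tau> = - F (\<eta> (\<psi> \<tau>)) - d"
      by (simp add: E_def F'_def \<tau>)
    show ?thesis
    proof (rule continuity_bootstrap[of \<tau> t E C "C + \<epsilon>"])
      show "continuous_on {\<tau>..t} E"
        by (meson E_deriv DERIV_isCont continuous_at_imp_continuous_on)
      show "E \<tau> \<le> C"
        using F_bound[of "\<eta> (\<psi> \<tau>)"] C_ge by (auto simp: E\<tau> abs_le_iff)
      fix s assume s: "s \<in> {\<tau>..t}" and small: "\<And>u. u \<in> {\<tau>..s} \<Longrightarrow> E u \<le> C + \<epsilon>"
      have E_in: "E u \<in> {- d - M..C + \<epsilon>}" if "u \<in> {\<tau>..s}" for u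
        using small[OF that] E_ge[of u] by simp
      define z where "z u = K (E u)" for u
      \<comment> \<open>While the energy stays below \<open>C + \<epsilon>\<close>, the clamp is the
        identity, and the derivative of the inverse cancels \<open>h\<close>.\<close>
      have z_deriv: "(z has_real_derivative \<gamma> u * p u) (at u)" if u: "u \<in> {\<tau>..s}" for u
      proof -
        obtain K' where K': "(K has_real_derivative K') (at (E u))" "K' * h (K (E u)) = 1"
          using Hinv_deriv[OF h_cont J_interval(1) H_diffeo] E_in[OF u] J_large unfolding K_def by blast
        have "(z has_real_derivative K' * (p u * (\<gamma> u * k (E u)))) (at u)"
          unfolding z_def by (rule DERIV_chain2[where f = K and g = E and x = u, OF K'(1) E_deriv])
        also have "K' * (p u * (\<gamma> u * k (E u))) = (K' * h (K (E u))) * (\<gamma> u * p u)"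
          by (simp add: k_def cl_id[OF E_in[OF u]])
        finally show ?thesis
          by (simp add: K'(2))
      qed
      have Ez: "E u \<le> g \<bar>z u\<bar>" if "u \<in> {\<tau>..s}" for u
        using ii[of "z u"] HK[of "E u"] E_in[OF that] J_large by (auto simp: z_def)
      have p_le: "\<bar>p u\<bar> \<le> sqrt (2 * g \<bar>z u\<bar>) + A" if u: "u \<in> {\<tau>..s}" for u
      proof -
        have "(p u)\<^sup>2 = 2 * (E u + F (\<eta> (\<psi> u)) + d)"
          by (simp add: E_def F'_def)
        also have "\<dots> \<le> 2 * g \<bar>z u\<bar> + 2 * (M + \<bar>d\<bar>)"
          using Ez[OF u] abs_le_D1[OF F_bound[of "\<eta> (\<psi> u)"]] abs_ge_self[of d] by simp
        finally have "\<bar>p u\<bar> \<le> sqrt (2 * g \<bar>z u\<bar> + 2 * (M + \<bar>d\<bar>))"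
          by (intro real_le_rsqrt) simp
        also have "\<dots> \<le> sqrt (2 * g \<bar>z u\<bar>) + A"
          unfolding A_def using M0 g_nonneg[of "\<bar>z u\<bar>"] by (intro sqrt_add_le_add_sqrt) auto
        finally show ?thesis .
      qed
      have "G_fun g \<bar>z s\<bar> \<le> G_fun g (N + \<Gamma> * A) + ereal \<Gamma>"
      proof (rule bihari[where a = \<tau> and b = s and c = "\<lambda>s. \<bar>\<gamma> s\<bar>"])
        show "(primitive (\<lambda>s. \<bar>\<gamma> s\<bar>) has_real_derivative \<bar>\<gamma> u\<bar>) (at u)" for u
          by (rule primitive_deriv[OF abs\<gamma>_cont])
        \<comment> \<open>Since \<open>s \<le> t < \<tau> + 1\<close>, the integral from
          \<open>\<tau>\<close> to \<open>s\<close> is at most the one over a full period, which is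
          \<open>\<Gamma>\<close>.\<close>
        have "primitive (\<lambda>s. \<bar>\<gamma> s\<bar>) s \<le> primitive (\<lambda>s. \<bar>\<gamma> s\<bar>) (\<tau> + 1)"
          using primitive_has_integral[OF abs\<gamma>_cont, of s "\<tau> + 1"] s \<tau>
          by (auto dest!: has_integral_nonneg)
        also have "\<dots> = primitive (\<lambda>s. \<bar>\<gamma> s\<bar>) \<tau> + \<Gamma>"
          using primitive_shift[OF abs\<gamma>_cont, of \<tau> 0] \<gamma>_periodic by (simp add: one_periodic_def \<Gamma>_eq)
        finally show "primitive (\<lambda>s. \<bar>\<gamma> s\<bar>) s - primitive (\<lambda>s. \<bar>\<gamma> s\<bar>) \<tau> \<le> \<Gamma>"
          by simp
        show "\<bar>z \<tau>\<bar> \<le> N"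
          by (simp add: z_def E\<tau> N)
        show "\<bar>\<gamma> u * p u\<bar> \<le> \<bar>\<gamma> u\<bar> * (sqrt (2 * g \<bar>z u\<bar>) + A)" if "u \<in> {\<tau>..s}" for u
          unfolding abs_mult by (intro mult_left_mono p_le[OF that]) simp
      qed (use s z_deriv A0 continuous_on_subset[OF abs\<gamma>_cont] in auto)
      \<comment> \<open>The right-hand side equals \<open>G_fun g Z\<close>, and strict monotonicity
        allows \<open>G\<close> to be cancelled.\<close>
      then have "\<bar>z s\<bar> \<le> Z"
        using G_fun_strict_mono[of Z "\<bar>z s\<bar>"] Z0 by (simp add: GZ[symmetric] not_less[symmetric]) blast
      then have "g \<bar>z s\<bar> \<le> g Z"
        using Z0 by (intro mono_onD[OF g_mono]) auto
      \<comment> \<open>\<open>C\<close> equals \<open>g Z\<close> plus the nonnegative quantity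
        \<open>\<bar>d\<bar> - d + 2 * M\<close>.\<close>
      then show "E s \<le> C"
        using Ez[of s] s M0 abs_ge_self[of d] unfolding C_def M1_sq by simp
    qed (use \<tau> \<epsilon> in auto)
  qed

  \<comment> \<open>Removal of the truncations\<close>
  have p_bound: "\<bar>p t\<bar> \<le> R" for t
  proof -
    have "(p t)\<^sup>2 = 2 * (E t + F (\<eta> (\<psi> t)) + d)"
      by (simp add: E_def F'_def)
    also have "\<dots> \<le> 2 * (C + M + d)"
      using E_le[of t] abs_le_D1[OF F_bound[of "\<eta> (\<psi> t)"]] by simp
    finally show ?thesis
      unfolding R_def by (intro real_le_rsqrt) simp
  qed
  have \<psi>_bound: "\<bar>\<psi> t\<bar> \<le> R" for t
  proof -
    have "\<psi> 0 = 0"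
      using \<psi>_odd unfolding odd_fun_def by (metis add.inverse_neutral equal_neg_zero)
    moreover have "\<psi> (frac t) = \<psi> t"
      using one_periodic_add_int[OF \<psi>_per, of "frac t" "\<lfloor>t\<rfloor>"] by (simp add: frac_def)
    moreover have "\<bar>\<psi> (frac t) - \<psi> 0\<bar> \<le> R * \<bar>frac t - 0\<bar>"
      using field_differentiable_bound[of UNIV \<psi> p R "frac t" 0] \<psi> p_bound by auto
    moreover have "R * \<bar>frac t - 0\<bar> \<le> R * 1"
      using p_bound[of 0] frac_lt_1[of t] by (intro mult_left_mono) auto
    ultimately show ?thesis by simp
  qed
  have E_eq: "E t = (p t)\<^sup>2 / 2 - primitive f (\<psi> t) - d" for t
    by (simp add: E_def F'_def F_def \<eta>_id[OF \<psi>_bound])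
  have E_range: "E t \<in> {- d - M..C + \<epsilon>}" for t
    using E_ge[of t] E_le[of t] \<epsilon>(1) by simp
  have "is_solution h f \<gamma> I J d \<psi>"
    unfolding is_solution_def
  proof (intro exI conjI allI)
    show "(\<psi> has_real_derivative p t) (at t)" "(p has_real_derivative \<Phi> (t, \<psi> t, p t)) (at t)" for t
      by (fact \<psi> p)+
    have "continuous_on UNIV \<psi>" "continuous_on UNIV p"
      by (meson \<psi> p DERIV_isCont continuous_at_imp_continuous_on)+
    then show "continuous_on UNIV (\<lambda>t. \<Phi> (t, \<psi> t, p t))"
      by (intro continuous_on_compose2[OF \<Phi>_cont] continuous_intros) auto
    show "(p t)\<^sup>2 / 2 - primitive f (\<psi> t) - d \<in> J" for t
      using E_range[of t] J_large unfolding E_eq by blast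
    show "\<Phi> (t, \<psi> t, p t) = f (\<psi> t) + \<gamma> t * h (Hinv h I ((p t)\<^sup>2 / 2 - primitive f (\<psi> t) - d))" for t
      unfolding E_eq[symmetric]
      by (simp add: \<Phi>_def E_def[symmetric] k_def cl_id[OF E_range] K_def[symmetric] f'_eq[OF \<psi>_bound])
  qed
  with \<psi>_odd \<psi>_per show ?thesis
    by blast
qed

end
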